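(* Let $lepM_{2,1}$ have a generating set $\Gamma_{lepM_{2,1}}\cup\{\tau_{i,j}:1\le i<j\}$ with $\Gamma_{lepM_{2,1}}$ finite, and let circuits be built from any finite universal set of gates together with the wire-swapping operations $\{\tau_{i,j}:1\le i<j\}$. The word-length asymmetry function $\lambda$ of the group $lpG_{2,1}$ within the monoid $lepM_{2,1}$ (over this generating set) is linearly equivalent to the computational asymmetry function $\alpha$: $$\alpha\ \simeq_{\rm lin}\ \lambda .$$ Moreover, $\Gamma_{lepM_{2,1}}$ can be chosen to consist exactly of the gates used in the circuits; then $\alpha=\lambda$.
   Context: Thompson group and monoid. Let $A=\{0,1\}$, let $A^*$ be the set of finite words over $A$, and $|w|$ the length of $w$. A right ideal is a set $R\subseteq A^*$ with $RA^*\subseteq R$; it is essential if it meets every (non-empty) right ideal. A prefix code is a set of words none of which is a prefix of another one; it is maximal if it is not a strict subset of another prefix code. A right-ideal homomorphism is a total function $\varphi:R_1\to A^*$ on a right ideal $R_1={\rm Dom}(\varphi)$ such that $\varphi(rz)=\varphi(r)z$ for all $r\in R_1$, $z\in A^*$; its image is a right ideal. A right ideal $R'\subseteq R$ is essential in $R$ iff $R'$ meets every right ideal that $R$ meets. $\Phi$ is an essential restriction of $\varphi$ (and $\varphi$ an essential extension of $\Phi$) iff $\Phi$ is a restriction of $\varphi$ to a right ideal that is essential in ${\rm Dom}(\varphi)$. Every homomorphism $\varphi$ between finitely generated right ideals has a unique maximal essential extension $\max(\varphi)$; $\varphi$ is said to represent $\max(\varphi)$. The monoid $M_{2,1}$ consists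 of all maximum essential extensions of homomorphisms between finitely generated right ideals of $A^*$, with product $\varphi\cdot\psi=\max(\varphi\circ\psi)$. Its group of invertible elements is the Thompson group $G_{2,1}$, consisting of all maximally extended isomorphisms between finitely generated essential right ideals. $lpG_{2,1}=\{\varphi\in G_{2,1}:|\varphi(x)|=|x|\ \forall x\in{\rm Dom}(\varphi)\}$. The submonoid $lepM_{2,1}$ consists of the elements of $M_{2,1}$ represented by a right-ideal homomorphism $\varphi:PA^*\to QA^*$, with $P,Q$ finite prefix codes and $P$ maximal, such that for all $x_1,x_2\in{\rm Dom}(\varphi)$: $|x_1|=|x_2|$ implies $|\varphi(x_1)|=|\varphi(x_2)|$. The bit transposition $\tau_{i,j}$ is the map $ux_ivx_jw\mapsto ux_jvx_iw$, where $|u|=i-1$, $|v|=j-i-1$, $x_i,x_j\in\{0,1\}$, $w\in\{0,1\}^*$. Word-length $|\cdot|_\Gamma$ over a generating set $\Gamma$ is the minimum length of a word over $\Gamma$ representing the element. Word-length asymmetry. For a group $G$ contained in a monoid $M$ with generating set $\Gamma$: $\lambda(n)=\max\{|g^{-1}|_\Gamma: |g|_\Gamma\le n,\ g\in G\}$. Circuits. A combinational circuit for $f:\{0,1\}^m\to\{0,1\}^n$ is an acyclic boolean circuit with $m$ input ports and $n$ output ports made from gates (traditionally and, or, not, fork: $x\mapsto(x,x)$; here a finite universal set), each applicable to any wires, and wire-swappings $\tau_{i,j}$. Its size is the number of gates, including forks and wire-swappings, as well as the input ports and the output ports; $C(f)$ is the smallest size of a circuit with input-output function $f$. The computational asymmetry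 function is $$\alpha(s)=\max\{C(f^{-1}): C(f)\le s,\ f \text{ a permutation of }\{0,1\}^m,\ m>0\}.$$ Functions $f_1,f_2:\mathbb N\to\mathbb N$ are linearly equivalent, $f_1\simeq_{\rm lin}f_2$, iff there are constants $c_0,c_1,c_2>0$ such that for all $n\ge c_0$: $f_1(n)\le c_1f_2(c_1n)$ and $f_2(n)\le c_2f_1(c_2n)$.
   Formalization: The equality α=λ fails as stated (ports make α(1) a maximum over the empty set, yet λ(1)≥1 by τ_{1,2}); it is proved for circuits with gates on the leading wires, ports not counted and unchanged extra wires allowed. The linear equivalence uses the original α. *)

theory Defs
  imports "HOL-Algebra.Group" "HOL-Library.Sublist" Complex_Main
begin

section \<open>Right ideals and prefix codes of \<open>{0,1}*\<close>\<close>

type_synonym word = "bool list"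

definition words :: "nat \<Rightarrow> word set" where
  "words m = {x. length x = m}"

definition right_ideal :: "word set \<Rightarrow> bool" where
  "right_ideal R \<longleftrightarrow> (\<forall>r\<in>R. \<forall>z. r @ z \<in> R)"

definition essential :: "word set \<Rightarrow> bool" where
  "essential R \<longleftrightarrow> right_ideal R \<and> (\<forall>S. right_ideal S \<and> S \<noteq> {} \<longrightarrow> R \<inter> S \<noteq> {})"

definition essential_in :: "word set \<Rightarrow> word set \<Rightarrow> bool" where
  "essential_in R' R \<longleftrightarrow> R' \<subseteq> R \<and> (\<forall>S. right_ideal S \<and> R \<inter> S \<noteq> {} \<longrightarrow> R' \<inter> S \<noteq> {})"

definition ideal_of :: "word set \<Rightarrow> word set" where
  "ideal_of P = {p @ z | p z. p \<in> P}"

definition fg_right_ideal :: "word set \<Rightarrow> bool" where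
  "fg_right_ideal R \<longleftrightarrow> (\<exists>P. finite P \<and> R = ideal_of P)"

definition prefix_code :: "word set \<Rightarrow> bool" where
  "prefix_code P \<longleftrightarrow> (\<forall>u\<in>P. \<forall>v\<in>P. prefix u v \<longrightarrow> u = v)"

definition maximal_prefix_code :: "word set \<Rightarrow> bool" where
  "maximal_prefix_code P \<longleftrightarrow> prefix_code P \<and> (\<forall>P'. prefix_code P' \<longrightarrow> \<not> P \<subset> P')"

section \<open>Right-ideal homomorphisms and maximal essential extensions\<close>

text \<open>A right-ideal homomorphism is encoded as a partial function on words whose domain is the
  right ideal on which the homomorphism is (totally) defined.\<close>

definition ri_hom :: "(word \<rightharpoonup> word) \<Rightarrow> bool" where
  "ri_hom \<phi> \<longleftrightarrow> right_ideal (dom \<phi>) \<and> (\<forall>r\<in>dom \<phi>. \<forall>z. \<phi> (r @ z) = Some (the (\<phi> r) @ z))"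

definition ri_hom_between :: "(word \<rightharpoonup> word) \<Rightarrow> word set \<Rightarrow> word set \<Rightarrow> bool" where
  "ri_hom_between \<phi> R S \<longleftrightarrow> ri_hom \<phi> \<and> dom \<phi> = R \<and> ran \<phi> \<subseteq> S"

definition ri_iso_between :: "(word \<rightharpoonup> word) \<Rightarrow> word set \<Rightarrow> word set \<Rightarrow> bool" where
  "ri_iso_between \<phi> R S \<longleftrightarrow> ri_hom \<phi> \<and> dom \<phi> = R \<and> ran \<phi> = S \<and> inj_on \<phi> (dom \<phi>)"

definition essential_extension :: "(word \<rightharpoonup> word) \<Rightarrow> (word \<rightharpoonup> word) \<Rightarrow> bool" where
  "essential_extension \<Psi> \<phi> \<longleftrightarrow> ri_hom \<Psi> \<and> ri_hom \<phi> \<and> \<phi> \<subseteq>\<^sub>m \<Psi> \<and> essential_in (dom \<phi>) (dom \<Psi>)"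

definition max_ext :: "(word \<rightharpoonup> word) \<Rightarrow> (word \<rightharpoonup> word)" where
  "max_ext \<phi> = (THE \<Psi>. essential_extension \<Psi> \<phi> \<and>
     (\<forall>\<Theta>. essential_extension \<Theta> \<phi> \<and> \<Psi> \<subseteq>\<^sub>m \<Theta> \<longrightarrow> \<Theta> = \<Psi>))"

section \<open>The Thompson monoid and the groups and monoids in it\<close>

definition M21 :: "(word \<rightharpoonup> word) monoid" where
  "M21 = \<lparr>carrier = {max_ext \<phi> | \<phi> R S.
                       fg_right_ideal R \<and> fg_right_ideal S \<and> ri_hom_between \<phi> R S},
          mult = (\<lambda>\<phi> \<psi>. max_ext (\<phi> \<circ>\<^sub>m \<psi>)),
          one = Some\<rparr>"

definition G21 :: "(word \<rightharpoonup> word) set" where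
  "G21 = {max_ext \<phi> | \<phi> R S. fg_right_ideal R \<and> essential R \<and>
            fg_right_ideal S \<and> essential S \<and> ri_iso_between \<phi> R S}"

definition lpG21 :: "(word \<rightharpoonup> word) set" where
  "lpG21 = {\<phi> \<in> G21. \<forall>x\<in>dom \<phi>. length (the (\<phi> x)) = length x}"

definition lepM21 :: "(word \<rightharpoonup> word) monoid" where
  "lepM21 = M21\<lparr>carrier := {max_ext \<phi> | \<phi> P Q.
      finite P \<and> maximal_prefix_code P \<and> finite Q \<and> prefix_code Q \<and>
      ri_hom_between \<phi> (ideal_of P) (ideal_of Q) \<and>
      (\<forall>x\<^sub>1\<in>dom \<phi>. \<forall>x\<^sub>2\<in>dom \<phi>. length x\<^sub>1 = length x\<^sub>2 \<longrightarrow>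
         length (the (\<phi> x\<^sub>1)) = length (the (\<phi> x\<^sub>2)))}\<rparr>"

text \<open>Bit positions are numbered from 1, list positions from 0.\<close>

definition tau_map :: "nat \<Rightarrow> nat \<Rightarrow> (word \<rightharpoonup> word)" where
  "tau_map i j x = (if j \<le> length x
     then Some (x[i - 1 := x ! (j - 1), j - 1 := x ! (i - 1)]) else None)"

definition bit_transpositions :: "(word \<rightharpoonup> word) set" where
  "bit_transpositions = {max_ext (tau_map i j) | i j. 1 \<le> i \<and> i < j}"

section \<open>Word length and word-length asymmetry\<close>

definition word_product :: "('a, 'b) monoid_scheme \<Rightarrow> 'a list \<Rightarrow> 'a" where
  "word_product M ws = foldr (mult M) ws (one M)"

definition generates :: "('a, 'b) monoid_scheme \<Rightarrow> 'a set \<Rightarrow> bool" where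
  "generates M \<Gamma> \<longleftrightarrow> \<Gamma> \<subseteq> carrier M \<and> carrier M = word_product M ` lists \<Gamma>"

definition word_length :: "('a, 'b) monoid_scheme \<Rightarrow> 'a set \<Rightarrow> 'a \<Rightarrow> nat" where
  "word_length M \<Gamma> x = (LEAST n. \<exists>ws\<in>lists \<Gamma>. word_product M ws = x \<and> length ws = n)"

text \<open>On \<^typ>\<open>nat\<close>, \<^const>\<open>Sup\<close> is the maximum of a finite non-empty set, and 0 for the empty set.\<close>

definition word_length_asymmetry ::
    "('a, 'b) monoid_scheme \<Rightarrow> 'a set \<Rightarrow> 'a set \<Rightarrow> nat \<Rightarrow> nat" where
  "word_length_asymmetry M G \<Gamma> n =
     Sup {word_length M \<Gamma> (inv\<^bsub>M\<^esub> g) | g. g \<in> G \<and> word_length M \<Gamma> g \<le> n}"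

section \<open>Gates and combinational circuits\<close>

datatype gate = Gate (gate_ins: nat) (gate_outs: nat) (gate_fun: "word \<Rightarrow> word")

definition valid_gate :: "gate \<Rightarrow> bool" where
  "valid_gate g \<longleftrightarrow> gate_fun g ` words (gate_ins g) \<subseteq> words (gate_outs g)"

definition swap_gate :: gate where
  "swap_gate = Gate 2 2 rev"

text \<open>A circuit is an acyclic graph listed in topological order. Wires are numbered: first the
  input ports, then the outputs of the successive nodes. Each node lists the wires feeding its
  gate, and \<open>outputs\<close> lists the wires leading to the output ports. As copying is done
  by explicit gates (such as fork), every wire is used exactly once. A wire-swapping is a
  \<^const>\<open>swap_gate\<close> node on the two wires concerned.\<close>

record circuit =
  nodes :: "(gate \<times> nat list) list"
  outputs :: "nat list"

fun wf_nodes :: "gate set \<Rightarrow> nat \<Rightarrow> (gate \<times> nat list) list \<Rightarrow> bool" where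
  "wf_nodes B k [] \<longleftrightarrow> True"
| "wf_nodes B k ((g, ps) # ns) \<longleftrightarrow> g \<in> B \<union> {swap_gate} \<and> length ps = gate_ins g \<and>
     set ps \<subseteq> {..<k} \<and> wf_nodes B (k + gate_outs g) ns"

definition wf_circuit :: "gate set \<Rightarrow> nat \<Rightarrow> nat \<Rightarrow> circuit \<Rightarrow> bool" where
  "wf_circuit B m n c \<longleftrightarrow> wf_nodes B m (nodes c) \<and> length (outputs c) = n \<and>
     (let used = concat (map snd (nodes c)) @ outputs c
      in distinct used \<and> set used = {..<m + sum_list (map (gate_outs \<circ> fst) (nodes c))})"

fun eval_nodes :: "(gate \<times> nat list) list \<Rightarrow> word \<Rightarrow> word" where
  "eval_nodes [] vals = vals"
| "eval_nodes ((g, ps) # ns) vals = eval_nodes ns (vals @ gate_fun g (map ((!) vals) ps))"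

definition eval_circuit :: "circuit \<Rightarrow> word \<Rightarrow> word" where
  "eval_circuit c x = map ((!) (eval_nodes (nodes c) x)) (outputs c)"

definition computes :: "gate set \<Rightarrow> nat \<Rightarrow> nat \<Rightarrow> circuit \<Rightarrow> (word \<Rightarrow> word) \<Rightarrow> bool" where
  "computes B m n c f \<longleftrightarrow> wf_circuit B m n c \<and> (\<forall>x\<in>words m. eval_circuit c x = f x)"

definition universal :: "gate set \<Rightarrow> bool" where
  "universal B \<longleftrightarrow> (\<forall>g\<in>B. valid_gate g) \<and>
     (\<forall>m n f. 0 < m \<and> 0 < n \<and> f ` words m \<subseteq> words n \<longrightarrow> (\<exists>c. computes B m n c f))"

text \<open>The summands \<open>m\<close> and \<open>n\<close> count the input and output ports.\<close>

definition circuit_complexity :: "gate set \<Rightarrow> nat \<Rightarrow> nat \<Rightarrow> (word \<Rightarrow> word) \<Rightarrow> nat" where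
  "circuit_complexity B m n f = (LEAST s. \<exists>c. computes B m n c f \<and> length (nodes c) + m + n = s)"

text \<open>Asymmetry of a complexity measure \<open>C m f\<close> for permutations \<open>f\<close> of \<open>{0,1}\<^sup>m\<close>.\<close>

definition asymmetry :: "(nat \<Rightarrow> (word \<Rightarrow> word) \<Rightarrow> nat) \<Rightarrow> nat \<Rightarrow> nat" where
  "asymmetry C s = Sup {C m (inv_into (words m) f) | m f.
     0 < m \<and> bij_betw f (words m) (words m) \<and> C m f \<le> s}"

definition computational_asymmetry :: "gate set \<Rightarrow> nat \<Rightarrow> nat" where
  "computational_asymmetry B = asymmetry (\<lambda>m. circuit_complexity B m m)"

section \<open>Gates as monoid elements, and circuits laid out as words over the gates\<close>

definition gate_map :: "gate \<Rightarrow> (word \<rightharpoonup> word)" where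
  "gate_map g x = (if gate_ins g \<le> length x
     then Some (gate_fun g (take (gate_ins g) x) @ drop (gate_ins g) x) else None)"

definition gate_elements :: "gate set \<Rightarrow> (word \<rightharpoonup> word) set" where
  "gate_elements B = (\<lambda>g. max_ext (gate_map g)) ` B"

text \<open>A serial circuit acts on an ordered bundle of wires. A gate takes the first wires of the
  bundle; wires are brought there by explicit wire-swappings. Its size is the number of gates
  and wire-swappings, without the ports.

  This accounting is the one for which the computational asymmetry is equal to the word-length
  asymmetry, and not only linearly equivalent to it. With ports counted, equality is impossible:
  every circuit then has size at least 2, so that no permutation has a circuit of size 1, whereas
  there are generators of word length 1 in \<^const>\<open>lpG21\<close>.\<close>

datatype step = Apply gate | Swap nat nat

fun wf_step :: "gate set \<Rightarrow> step \<Rightarrow> bool" where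
  "wf_step B (Apply g) \<longleftrightarrow> g \<in> B"
| "wf_step B (Swap i j) \<longleftrightarrow> 1 \<le> i \<and> i < j"

fun step_map :: "step \<Rightarrow> (word \<rightharpoonup> word)" where
  "step_map (Apply g) = gate_map g"
| "step_map (Swap i j) = tau_map i j"

fun run_steps :: "step list \<Rightarrow> word \<Rightarrow> word option" where
  "run_steps [] x = Some x"
| "run_steps (s # ss) x = Option.bind (step_map s x) (run_steps ss)"

text \<open>The bundle may contain further wires beyond the \<open>m\<close> inputs of \<open>f\<close>, provided that they
  leave the circuit unchanged: as an element of the monoid, \<open>f\<close> is identified with the
  map applying \<open>f\<close> to the first \<open>m\<close> bits of a longer word, and a step acting on a borrowed
  wire is legitimate in a word over the generators.\<close>

definition serial_computes :: "gate set \<Rightarrow> nat \<Rightarrow> step list \<Rightarrow> (word \<Rightarrow> word) \<Rightarrow> bool" where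
  "serial_computes B m ss f \<longleftrightarrow> (\<forall>s\<in>set ss. wf_step B s) \<and>
     (\<exists>M\<ge>m. \<forall>x\<in>words M. run_steps ss x = Some (f (take m x) @ drop m x))"

definition serial_complexity :: "gate set \<Rightarrow> nat \<Rightarrow> (word \<Rightarrow> word) \<Rightarrow> nat" where
  "serial_complexity B m f = (LEAST k. \<exists>ss. serial_computes B m ss f \<and> length ss = k)"

definition serial_asymmetry :: "gate set \<Rightarrow> nat \<Rightarrow> nat" where
  "serial_asymmetry B = asymmetry (serial_complexity B)"

section \<open>Linear equivalence\<close>

definition lin_equiv :: "(nat \<Rightarrow> nat) \<Rightarrow> (nat \<Rightarrow> nat) \<Rightarrow> bool" (infix "\<simeq>\<^sub>l\<^sub>i\<^sub>n" 50) where
  "f\<^sub>1 \<simeq>\<^sub>l\<^sub>i\<^sub>n f\<^sub>2 \<longleftrightarrow> (\<exists>c\<^sub>0>0. \<exists>c\<^sub>1>0. \<exists>c\<^sub>2>0. \<forall>n\<ge>c\<^sub>0.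
     f\<^sub>1 n \<le> c\<^sub>1 * f\<^sub>2 (c\<^sub>1 * n) \<and> f\<^sub>2 n \<le> c\<^sub>2 * f\<^sub>1 (c\<^sub>2 * n))"

end

theory Submission
  imports Defs
begin

text \<open>
  A homomorphism representing an element of \<^const>\<open>lepM21\<close> restricts to a function
  \<open>{0,1}\<^sup>m \<rightarrow> {0,1}\<^sup>n\<close>, and two of them have the same maximal extension iff they agree on
  all long words. Hence words over the gates and bit transpositions are the same thing as serial
  programs, which gives the equality of the two asymmetries; passing to another finite part of the
  generating set changes word lengths only by a constant factor.

  A circuit becomes a serial program by moving the input wires of each gate to the front.
  Conversely, a program of length \<open>k\<close> touches only \<open>O(k)\<close> wires and can be replayed on any set of
  wires containing these. So a permutation with a short program is, up to \<open>O(k)\<close> transpositions, a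
  permutation of \<open>O(k)\<close> wires, and borrowed wires can be replaced by \<open>O(k)\<close> constant wires
  that are created and deleted by gates. Counting the ports is harmless: reversing \<open>n\<close> wires
  touches all but one of them, so the serial asymmetry grows at least linearly.
\<close>

section \<open>Circuits and serial programs\<close>

text \<open>The suprema are the obstacle. \<open>Sup\<close> on the naturals bounds its members only
  if they are bounded. Circuit size counts ports, so a size bound leaves finitely many functions.
  Word length does not: infinitely many transpositions have length 1, and counting gives no bound on
  the lengths of the inverses. That bound has to come out of the comparison with \<alpha>, by
  compressing a short program to a permutation of few wires before anything is known about the
  supremum.

  Compression has its own difficulty. Which wires of the initial bundle matter is decided by later
  steps, and gates shift positions; so the touched set is pulled back from the end of the program,
  and the simulation is stated for every larger set as well. One direction uses this freedom to make
  the set nonempty, the other to include all inputs.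

  Additive terms are absorbed on both sides: besides reversal for the serial asymmetry, the identity
  gives \<open>2 n \<le> \<alpha>(2 n)\<close>.\<close>

lemma in_words [simp]: "x \<in> words m \<longleftrightarrow> length x = m"
  by (simp add: words_def)

abbreviation wf_steps :: "gate set \<Rightarrow> step list \<Rightarrow> bool" where
  "wf_steps B ss \<equiv> \<forall>s\<in>set ss. wf_step B s"

section \<open>Serial programs on bundles of varying size\<close>

lemma run_steps_append: "run_steps (ss @ ts) x = Option.bind (run_steps ss x) (run_steps ts)"
  by (induction ss arbitrary: x) (auto split: bind_splits)

lemma tau_map_map:
  assumes "1 \<le> i" "i < j" "j \<le> length p"
  shows "tau_map i j (map h p) = Some (map h (p[i - 1 := p ! (j - 1), j - 1 := p ! (i - 1)]))"
  using assms by (simp add: tau_map_def map_update)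

lemma step_map_append:
  assumes "wf_step B s" "step_map s x = Some y"
  shows "step_map s (x @ z) = Some (y @ z)"
proof (cases s)
  case (Apply g)
  then show ?thesis using assms by (auto simp: gate_map_def split: if_splits)
next
  case (Swap i j)
  then show ?thesis using assms
    by (auto simp: tau_map_def list_update_append nth_append split: if_splits)
qed

text \<open>This makes programs right-ideal homomorphisms and lets a program for few wires run at
  the front of a larger bundle.\<close>

lemma run_steps_extend:
  assumes "wf_steps B ss" "run_steps ss x = Some y"
  shows "run_steps ss (x @ z) = Some (y @ z)"
  using assms
  by (induction ss arbitrary: x) (auto simp: step_map_append split: bind_splits)

lemma step_map_length:
  assumes "\<forall>g\<in>B. valid_gate g" "wf_step B s" "step_map s x = Some y" "length x' = length x"
  shows "\<exists>y'. step_map s x' = Some y' \<and> length y' = length y"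
proof (cases s)
  case (Apply g)
  then have v: "valid_gate g" and le: "gate_ins g \<le> length x" using assms
    by (auto simp: gate_map_def split: if_splits)
  have "length (gate_fun g u) = gate_outs g" if "length u = gate_ins g" for u
    using v that unfolding valid_gate_def by (metis image_subset_iff in_words)
  then show ?thesis using assms Apply le by (auto simp: gate_map_def)
next
  case (Swap i j)
  then show ?thesis using assms by (auto simp: tau_map_def split: if_splits)
qed

lemma run_steps_length:
  assumes "\<forall>g\<in>B. valid_gate g" "wf_steps B ss" "run_steps ss x = Some y" "length x' = length x"
  shows "\<exists>y'. run_steps ss x' = Some y' \<and> length y' = length y"
  using assms(2-)
proof (induction ss arbitrary: x x')
  case (Cons s ss)
  from Cons.prems obtain x1 where x1: "step_map s x = Some x1" "run_steps ss x1 = Some y"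
    by (auto split: bind_splits)
  then obtain x2 where "step_map s x' = Some x2" "length x2 = length x1"
    using step_map_length[OF assms(1), of s x x1 x'] Cons.prems by auto
  then show ?case using Cons.IH[of x1 x2] x1 Cons.prems by auto
qed auto

section \<open>Rearranging wires by transpositions\<close>

text \<open>The entries of \<open>p\<close> are wire labels and \<open>h\<close> is any assignment
  of bits to them: the swaps are chosen from the labels alone, so one program serves all inputs.
  Each label of \<open>t\<close> costs at most one swap, since positions already filled stay put;
  each swap is an involution, so the reversed list undoes the program.\<close>

lemma bring_to_front:
  fixes p :: "'a list"
  assumes "distinct p" "distinct t" "set t \<subseteq> set p"
  obtains ss p' where "wf_steps B ss" "length ss \<le> length t" "distinct p'" "set p' = set p"
    "take (length t) p' = t" "\<And>h. run_steps ss (map h p) = Some (map h p')"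
    "\<And>h. run_steps (rev ss) (map h p') = Some (map h p)"
  using assms(2,3)
proof (induction t arbitrary: thesis rule: rev_induct)
  case Nil
  show ?case by (rule Nil(1)[of "[]" p]) (use assms in auto)
next
  case (snoc v t)
  have "distinct t" "set t \<subseteq> set p" using snoc.prems by auto
  then obtain ss q where q: "wf_steps B ss" "length ss \<le> length t" "distinct q" "set q = set p"
    "take (length t) q = t" and run: "\<And>h. run_steps ss (map h p) = Some (map h q)"
      "\<And>h. run_steps (rev ss) (map h q) = Some (map h p)"
    using snoc.IH by blast
  define l where "l = length t"
  have "v \<in> set q" using snoc.prems q(4) by auto
  then obtain j where j: "j < length q" "q ! j = v"
    by (auto simp: in_set_conv_nth)
  \<comment> \<open>The first \<open>l\<close> positions hold \<open>t\<close>, which does not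
    contain \<open>v\<close>.\<close>
  have lj: "l \<le> j"
  proof (rule ccontr)
    assume "\<not> l \<le> j"
    then have "take (length t) q ! j = v" "j < length t" using j by (auto simp: l_def)
    then have "v \<in> set t" using q(5) nth_mem[of j t] by simp
    then show False using snoc.prems by simp
  qed
  \<comment> \<open>A label already in place must be left alone, as \<open>Swap i j\<close> is
    well-formed only for \<open>i < j\<close>.\<close>
  show ?case
  proof (cases "j = l")
    case True
    then have "take (length (t @ [v])) q = t @ [v]"
      using q(5) j by (simp add: l_def take_Suc_conv_app_nth)
    then show ?thesis using q run by (intro snoc.prems(1)[of ss q]) auto
  next
    case False
    then have lj: "l < j" using lj by auto
    define q' where "q' = q[l := q ! j, j := q ! l]"
    have 1: "tau_map (l + 1) (j + 1) (map h q) = Some (map h q')" for h :: "'a \<Rightarrow> bool"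
      using lj j tau_map_map[of "l + 1" "j + 1" q h] by (simp add: q'_def)
    have "q'[l := q' ! j, j := q' ! l] = q"
      using lj j by (intro nth_equalityI) (auto simp: q'_def nth_list_update)
    then have 2: "tau_map (l + 1) (j + 1) (map h q') = Some (map h q)" for h :: "'a \<Rightarrow> bool"
      using lj j tau_map_map[of "l + 1" "j + 1" q' h] by (simp add: q'_def)
    have 3: "set q' = set p" "distinct q'" using lj j q by (auto simp: q'_def)
    have 4: "take (length (t @ [v])) q' = t @ [v]"
      using lj j q(5) by (simp add: q'_def l_def take_Suc_conv_app_nth)
    show ?thesis
      by (rule snoc.prems(1)[of "ss @ [Swap (l + 1) (j + 1)]" q'])
        (use q run 1 2 3 4 lj in \<open>auto simp: run_steps_append\<close>)
  qed
qed

lemma permute_steps: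
  assumes "distinct t" "set t = {..<n}"
  obtains ss where "wf_steps B ss" "length ss \<le> n"
    "\<And>x. length x = n \<Longrightarrow> run_steps ss x = Some (map ((!) x) t)"
    "\<And>x. length x = n \<Longrightarrow> run_steps (rev ss) (map ((!) x) t) = Some x"
proof -
  have len: "length t = n" using distinct_card[OF assms(1)] assms(2) by simp
  have st: "set t \<subseteq> set [0..<n]" by (simp add: assms(2) lessThan_atLeast0)
  obtain ss p' where ss: "wf_steps B ss" "length ss \<le> length t" "distinct p'" "set p' = set [0..<n]"
    "take (length t) p' = t" "\<And>h. run_steps ss (map h [0..<n]) = Some (map h p')"
    "\<And>h. run_steps (rev ss) (map h p') = Some (map h [0..<n])"
    using bring_to_front[OF distinct_upt assms(1) st, of B] by blast
  have "length p' = n" using distinct_card[OF ss(3)] ss(4) by simp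
  then have p': "p' = t" using ss(5) len by simp
  have x: "map ((!) x) [0..<n] = x" if "length x = n" for x :: word
    using that map_nth by blast
  show ?thesis
  proof (rule that[of ss])
    show "run_steps ss x = Some (map ((!) x) t)" "run_steps (rev ss) (map ((!) x) t) = Some x"
      if "length x = n" for x
      using ss(6)[of "(!) x"] ss(7)[of "(!) x"] x[OF that] p' by auto
  qed (use ss len in auto)
qed

section \<open>From circuits to serial programs\<close>

lemma valid_gate_length:
  "valid_gate g \<Longrightarrow> length u = gate_ins g \<Longrightarrow> length (gate_fun g u) = gate_outs g"
  unfolding valid_gate_def by (metis image_subset_iff in_words)

lemma valid_swap_gate: "valid_gate swap_gate"
  by (auto simp: valid_gate_def swap_gate_def)

lemma node_step:
  assumes "g \<in> B \<union> {swap_gate}"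
  shows "\<exists>s. wf_step B s \<and> (\<forall>u z. length u = gate_ins g \<longrightarrow> step_map s (u @ z) = Some (gate_fun g u @ z))"
proof (cases "g \<in> B")
  case True
  then show ?thesis by (intro exI[of _ "Apply g"]) (auto simp: gate_map_def)
next
  case False
  then have g: "g = swap_gate" using assms by auto
  show ?thesis
  proof (intro exI[of _ "Swap 1 2"] conjI allI impI)
    fix u z :: word
    assume "length u = gate_ins g"
    then obtain a b where "u = [a, b]" by (auto simp: g swap_gate_def length_Suc_conv numeral_2_eq_2)
    then show "step_map (Swap 1 2) (u @ z) = Some (gate_fun g u @ z)"
      by (simp add: g swap_gate_def tau_map_def)
  qed auto
qed

text \<open>\<open>p\<close> lists the live wires in bundle order, \<open>vals\<close> holds the
  values of all wires created so far. The set equation expresses that every wire is used exactly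
  once: what is still to be used is what is live plus what the remaining nodes will create. A node
  costs at most \<open>d\<close> swaps to bring its inputs to the front and one step, hence
  \<open>Suc d\<close>.\<close>

lemma nodes_to_steps:
  assumes "\<forall>g\<in>B. valid_gate g" "\<forall>g\<in>B. gate_ins g \<le> d" "2 \<le> d"
    and "wf_nodes B k ns" "distinct (concat (map snd ns) @ os)"
    and "set (concat (map snd ns) @ os) = set p \<union> {k..<k + sum_list (map (gate_outs \<circ> fst) ns)}"
    and "distinct p" "set p \<subseteq> {..<k}"
  shows "\<exists>ss p'. wf_steps B ss \<and> length ss \<le> length ns * Suc d \<and> distinct p' \<and> set p' = set os \<and>
    (\<forall>vals. length vals = k \<longrightarrow>
      run_steps ss (map ((!) vals) p) = Some (map ((!) (eval_nodes ns vals)) p'))"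
  using assms(4-)
proof (induction ns arbitrary: k p)
  case Nil
  then show ?case by (intro exI[of _ "[]"] exI[of _ p]) auto
next
  case (Cons node ns)
  obtain g ps where node: "node = (g, ps)" by (cases node)
  have g: "g \<in> B \<union> {swap_gate}" and ps: "length ps = gate_ins g" "set ps \<subseteq> {..<k}"
    and wf: "wf_nodes B (k + gate_outs g) ns"
    using Cons.prems(1) by (auto simp: node)
  have vg: "valid_gate g" using g assms(1) valid_swap_gate by auto
  have gd: "gate_ins g \<le> d" using g assms(2,3) by (auto simp: swap_gate_def)
  define b where "b = gate_outs g"
  define rem where "rem = concat (map snd ns) @ os"
  define e where "e = k + b + sum_list (map (gate_outs \<circ> fst) ns)"
  have d: "distinct ps" "distinct rem" "set ps \<inter> set rem = {}"
    using Cons.prems(2) by (auto simp: node rem_def)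
  have U: "set ps \<union> set rem = set p \<union> {k..<e}"
    using Cons.prems(3) by (simp add: node rem_def e_def b_def add.assoc comp_def Un_assoc)
  \<comment> \<open>The inputs of the node lie below \<open>k\<close>, so they are not among the
    wires still to be created.\<close>
  have psp: "set ps \<subseteq> set p" using U ps(2) by fastforce
  obtain ss1 p1 where s1: "wf_steps B ss1" "length ss1 \<le> length ps" "distinct p1" "set p1 = set p"
      "take (length ps) p1 = ps" "\<And>h. run_steps ss1 (map h p) = Some (map h p1)"
    using bring_to_front[OF Cons.prems(4) d(1) psp, of B] by metis
  define rest where "rest = drop (length ps) p1"
  have p1: "p1 = ps @ rest" using s1(5) by (metis append_take_drop_id rest_def)
  obtain s where s: "wf_step B s"
    "\<And>u z. length u = gate_ins g \<Longrightarrow> step_map s (u @ z) = Some (gate_fun g u @ z)"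
    using node_step[OF g] by auto
  \<comment> \<open>The gate consumes the front \<open>ps\<close> and leaves its new wires, numbered
    from \<open>k\<close>, in their place.\<close>
  define p2 where "p2 = [k..<k + b] @ rest"
  have rk: "set rest \<subseteq> {..<k}" using s1(4) Cons.prems(5) p1 by auto
  have p2: "distinct p2" "set p2 \<subseteq> {..<k + b}"
    using s1(3) p1 rk by (auto simp: p2_def)
  have "set rem = set p2 \<union> {k + b..<e}"
  proof -
    have "set rem = (set p \<union> {k..<e}) - set ps" using U d(3) by auto
    also have "\<dots> = (set p - set ps) \<union> {k..<e}" using ps(2) by auto
    also have "set p - set ps = set rest" using s1(3,4) p1 by auto
    also have "{k..<e} = {k..<k+b} \<union> {k+b..<e}" by (auto simp: e_def)
    finally show ?thesis by (auto simp: p2_def)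
  qed
  then obtain ss2 p' where s2: "wf_steps B ss2" "length ss2 \<le> length ns * Suc d" "distinct p'"
    "set p' = set os" "\<And>vals. length vals = k + b \<Longrightarrow>
      run_steps ss2 (map ((!) vals) p2) = Some (map ((!) (eval_nodes ns vals)) p')"
    using Cons.IH[OF wf[folded b_def] d(2)[unfolded rem_def], of p2] p2
    unfolding rem_def e_def by metis
  show ?case
  proof (intro exI[of _ "ss1 @ s # ss2"] exI[of _ p'] conjI allI impI)
    show "length (ss1 @ s # ss2) \<le> length (node # ns) * Suc d"
      using s1(2) s2(2) ps(1) gd by simp
    fix vals :: word
    assume v: "length vals = k"
    define w where "w = gate_fun g (map ((!) vals) ps)"
    have lw: "length w = b" using valid_gate_length[OF vg] ps(1) by (simp add: w_def b_def)
    have "map ((!) (vals @ w)) [k..<k + b] = w"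
      using v lw by (intro nth_equalityI) (auto simp: nth_append)
    moreover have "map ((!) (vals @ w)) rest = map ((!) vals) rest"
      using rk v by (auto simp: nth_append)
    ultimately have "map ((!) (vals @ w)) p2 = w @ map ((!) vals) rest" by (simp add: p2_def)
    then show "run_steps (ss1 @ s # ss2) (map ((!) vals) p) =
        Some (map ((!) (eval_nodes (node # ns) vals)) p')"
      using s2(5)[of "vals @ w"] v lw s(2) ps(1)
      by (simp add: run_steps_append s1(6) p1 node w_def[symmetric])
  qed (use s1 s2 s in auto)
qed

lemma circuit_to_steps:
  assumes "\<forall>g\<in>B. valid_gate g" "\<forall>g\<in>B. gate_ins g \<le> d" "2 \<le> d" "computes B m n c f"
  shows "\<exists>ss. wf_steps B ss \<and> length ss \<le> length (nodes c) * Suc d + n \<and>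
    (\<forall>x\<in>words m. run_steps ss x = Some (f x))"
proof -
  have c: "wf_nodes B m (nodes c)" "length (outputs c) = n"
    "distinct (concat (map snd (nodes c)) @ outputs c)"
    "set (concat (map snd (nodes c)) @ outputs c) = {..<m + sum_list (map (gate_outs \<circ> fst) (nodes c))}"
    and e: "\<And>x. length x = m \<Longrightarrow> eval_circuit c x = f x"
    using assms(4) by (auto simp: computes_def wf_circuit_def Let_def)
  have c4: "set (concat (map snd (nodes c)) @ outputs c) =
      set [0..<m] \<union> {m..<m + sum_list (map (gate_outs \<circ> fst) (nodes c))}"
    unfolding c(4) by auto
  obtain ss p' where s: "wf_steps B ss" "length ss \<le> length (nodes c) * Suc d" "distinct p'"
    "set p' = set (outputs c)" "\<And>vals. length vals = m \<Longrightarrow>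
      run_steps ss (map ((!) vals) [0..<m]) = Some (map ((!) (eval_nodes (nodes c) vals)) p')"
    using nodes_to_steps[OF assms(1-3) c(1,3) c4] by (metis atLeast_upt distinct_upt order_refl)
  \<comment> \<open>At the end exactly the output wires are live, in an order left over by the
    swaps; rearranging them accounts for the summand \<open>n\<close>.\<close>
  have do: "distinct (outputs c)" using c(3) by simp
  obtain ss2 p2 where s2: "wf_steps B ss2" "length ss2 \<le> length (outputs c)" "distinct p2"
     "set p2 = set p'" "take (length (outputs c)) p2 = outputs c"
     "\<And>h. run_steps ss2 (map h p') = Some (map h p2)"
    using bring_to_front[OF s(3) do, of B] s(4) by (metis order_refl)
  have "length p2 = length (outputs c)"
    using s2(3,4) s(4) do by (metis distinct_card)
  then have p2: "p2 = outputs c" using s2(5) by simp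
  show ?thesis
  proof (intro exI[of _ "ss @ ss2"] conjI ballI)
    fix x :: word assume "x \<in> words m"
    then have x: "length x = m" by simp
    then have "map ((!) x) [0..<m] = x" using map_nth by blast
    then show "run_steps (ss @ ss2) x = Some (f x)"
      using s(5)[OF x] e[OF x] s2(6) by (simp add: run_steps_append p2 eval_circuit_def)
  qed (use s s2 c in auto)
qed

section \<open>From serial programs to circuits\<close>

lemma wf_nodes_append:
  "wf_nodes B k (ns @ ms) \<longleftrightarrow>
    wf_nodes B k ns \<and> wf_nodes B (k + sum_list (map (gate_outs \<circ> fst) ns)) ms"
  by (induction ns arbitrary: k rule: list.induct) (auto simp: add.assoc)

lemma eval_nodes_append: "eval_nodes (ns @ ms) vals = eval_nodes ms (eval_nodes ns vals)"
  by (induction ns vals rule: eval_nodes.induct) auto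

lemma eval_nodes_extends:
  assumes "\<forall>g\<in>B. valid_gate g" "wf_nodes B k ns" "length vals = k"
  shows "length (eval_nodes ns vals) = k + sum_list (map (gate_outs \<circ> fst) ns)"
  using assms(2,3)
proof (induction ns vals arbitrary: k rule: eval_nodes.induct)
  case (2 g ps ns vals)
  then have "valid_gate g" "length ps = gate_ins g" using assms(1) valid_swap_gate by auto
  then have "length (gate_fun g (map ((!) vals) ps)) = gate_outs g"
    by (simp add: valid_gate_length)
  then show ?case using 2 by (simp add: "2.IH"[of "k + gate_outs g"] add.assoc)
qed auto

text \<open>The gate becomes a new last node fed by the first output wires; its own wires get the
  next free numbers, from \<open>N\<close> on.\<close>

lemma computes_apply:
  assumes "\<forall>g\<in>B. valid_gate g" "g \<in> B" "computes B m n c f" "gate_ins g \<le> n"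
  shows "\<exists>c'. computes B m (n - gate_ins g + gate_outs g) c'
      (\<lambda>x. gate_fun g (take (gate_ins g) (f x)) @ drop (gate_ins g) (f x)) \<and>
    length (nodes c') = Suc (length (nodes c))"
proof -
  define a where "a = gate_ins g"
  define b where "b = gate_outs g"
  define N where "N = m + sum_list (map (gate_outs \<circ> fst) (nodes c))"
  define os where "os = outputs c"
  have c: "wf_nodes B m (nodes c)" "length os = n"
    "distinct (concat (map snd (nodes c)) @ os)"
    "set (concat (map snd (nodes c)) @ os) = {..<N}"
    and e: "\<And>x. length x = m \<Longrightarrow> map ((!) (eval_nodes (nodes c) x)) os = f x"
    using assms(3) by (auto simp: computes_def wf_circuit_def Let_def N_def os_def eval_circuit_def)
  define c' where "c' = \<lparr>nodes = nodes c @ [(g, take a os)], outputs = [N..<N + b] @ drop a os\<rparr>"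
  have os: "set os = set (take a os) \<union> set (drop a os)" "set (take a os) \<inter> set (drop a os) = {}"
    using c(3) by (metis append_take_drop_id set_append) (metis c(3) append_take_drop_id distinct_append)
  have osN: "set os \<subseteq> {..<N}" using c(4) by auto
  have dN: "i < N" if "i \<in> set (drop a os) \<or> i \<in> set (take a os)" for i using osN os(1) that by auto
  have "wf_circuit B m (n - a + b) c'"
    unfolding wf_circuit_def Let_def
  proof (intro conjI)
    show "wf_nodes B m (nodes c')"
      using c(1,2) assms(2,4) dN by (auto simp: c'_def wf_nodes_append N_def a_def)
    show "length (outputs c') = n - a + b" using c(2) by (simp add: c'_def)
    have cc: "set (concat (map snd (nodes c))) \<inter> set os = {}" using c(3) by simp
    have "set (concat (map snd (nodes c))) \<subseteq> {..<N}" using c(4) by auto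
    moreover have "set (take a os) \<subseteq> {..<N}" using dN by auto
    ultimately have "set (concat (map snd (nodes c))) \<inter> {N..<N+b} = {}"
      "set (take a os) \<inter> {N..<N+b} = {}" by fastforce+
    moreover have "set (drop a os) \<inter> {N..<N+b} = {}" using dN by fastforce
    ultimately have "distinct ((concat (map snd (nodes c)) @ take a os) @ ([N..<N + b] @ drop a os))"
      using c(3) cc os by (simp only: distinct_append set_append set_upt distinct_upt) auto
    then show "distinct (concat (map snd (nodes c')) @ outputs c')" by (simp add: c'_def)
    have "set (concat (map snd (nodes c')) @ outputs c') =
        set (concat (map snd (nodes c)) @ os) \<union> {N..<N+b}"
      using os(1) by (auto simp: c'_def)
    also have "\<dots> = {..<N + b}" unfolding c(4) by auto
    also have "N + b = m + sum_list (map (gate_outs \<circ> fst) (nodes c'))"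
      by (simp add: c'_def N_def b_def)
    finally show "set (concat (map snd (nodes c')) @ outputs c') =
        {..<m + sum_list (map (gate_outs \<circ> fst) (nodes c'))}" .
  qed
  moreover have "eval_circuit c' x = gate_fun g (take a (f x)) @ drop a (f x)" if x: "length x = m" for x
  proof -
    define v where "v = eval_nodes (nodes c) x"
    have lv: "length v = N" using eval_nodes_extends[OF assms(1) c(1) x] by (simp add: v_def N_def)
    define w where "w = gate_fun g (map ((!) v) (take a os))"
    have lw: "length w = b" using valid_gate_length assms c(2) by (simp add: w_def b_def a_def)
    have 1: "map ((!) (v @ w)) [N..<N + b] = w"
      using lv lw by (intro nth_equalityI) (auto simp: nth_append)
    have 2: "map ((!) (v @ w)) (drop a os) = map ((!) v) (drop a os)"
      using dN lv by (auto simp: nth_append)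
    show ?thesis
      using 1 2 e[OF x]
      by (simp add: eval_circuit_def c'_def eval_nodes_append v_def[symmetric] w_def[symmetric])
        (simp add: w_def take_map drop_map flip: e[OF x] v_def)
  qed
  ultimately show ?thesis
    by (intro exI[of _ c']) (auto simp: computes_def a_def b_def c'_def)
qed

text \<open>Transpositions are free in this direction: permuting the list of output wires adds no
  node.\<close>

lemma computes_permute:
  assumes "computes B m n c f" "distinct t" "set t = {..<n}"
  shows "\<exists>c'. computes B m n c' (\<lambda>x. map ((!) (f x)) t) \<and> nodes c' = nodes c"
proof -
  define c' where "c' = c\<lparr>outputs := map ((!) (outputs c)) t\<rparr>"
  have n: "length (outputs c) = n" "distinct (outputs c)"
    using assms(1) by (auto simp: computes_def wf_circuit_def Let_def)
  have lt: "length t = n" using distinct_card[OF assms(2)] assms(3) by simp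
  have st: "set (map ((!) (outputs c)) t) = set (outputs c)"
    using nth_image[of n "outputs c"] n(1) by (simp add: assms(3) lessThan_atLeast0)
  have "distinct (map ((!) (outputs c)) t)"
    using assms(2,3) n by (auto simp: distinct_map inj_on_def nth_eq_iff_index_eq)
  then have "wf_circuit B m n c'"
    using assms(1) lt st unfolding computes_def wf_circuit_def Let_def c'_def by simp
  moreover have "eval_circuit c' x = map ((!) (eval_circuit c x)) t" for x
    using assms(3) n by (auto simp: eval_circuit_def c'_def)
  ultimately show ?thesis using assms(1)
    by (intro exI[of _ c']) (auto simp: computes_def c'_def)
qed

lemma computes_cong:
  "computes B m n c f \<Longrightarrow> (\<And>x. length x = m \<Longrightarrow> f x = f' x) \<Longrightarrow> computes B m n c f'"
  by (auto simp: computes_def)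

lemma computes_length:
  assumes "computes B m n c f" "length x = m"
  shows "length (f x) = n"
proof -
  have "f x = eval_circuit c x" "length (outputs c) = n"
    using assms by (auto simp: computes_def wf_circuit_def)
  then show ?thesis by (simp add: eval_circuit_def)
qed

lemma computes_run_steps:
  assumes "\<forall>g\<in>B. valid_gate g" "computes B m n c f0" "wf_steps B ss"
    "\<And>x. length x = m \<Longrightarrow> run_steps ss (f0 x) = Some (f x)"
  shows "\<exists>n' c'. computes B m n' c' f \<and> length (nodes c') \<le> length (nodes c) + length ss"
  using assms(2-)
proof (induction ss arbitrary: n c f0)
  case Nil
  have "computes B m n c f" using Nil.prems(3) by (intro computes_cong[OF Nil.prems(1)]) simp
  then show ?case by auto
next
  case (Cons s ss)
  \<comment> \<open>A sample input: whether a step is defined depends only on the length of its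
    argument, so one word shows that the gate fits or that \<open>j \<le> n\<close>.\<close>
  define z where "z = replicate m False"
  have z: "step_map s (f0 z) \<noteq> None" "length (f0 z) = n"
    using Cons.prems(3)[of z] computes_length[OF Cons.prems(1), of z]
    by (auto simp: z_def split: bind_splits)
  have len: "length (f0 x) = n" if "length x = m" for x
    using computes_length[OF Cons.prems(1) that] .
  obtain c1 n1 f1 where c1: "computes B m n1 c1 f1" "length (nodes c1) \<le> Suc (length (nodes c))"
    "\<And>x. length x = m \<Longrightarrow> step_map s (f0 x) = Some (f1 x)"
  proof (cases s)
    case (Apply g)
    then have g: "g \<in> B" "gate_ins g \<le> n" using Cons.prems(2) z
      by (auto simp: gate_map_def split: if_splits)
    from computes_apply[OF assms(1) g(1) Cons.prems(1) g(2)] obtain c1 where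
      "computes B m (n - gate_ins g + gate_outs g) c1
        (\<lambda>x. gate_fun g (take (gate_ins g) (f0 x)) @ drop (gate_ins g) (f0 x))"
      "length (nodes c1) = Suc (length (nodes c))" by auto
    then show ?thesis using that g(2) len by (simp add: Apply gate_map_def)
  next
    case (Swap i j)
    then have ij: "1 \<le> i" "i < j" "j \<le> n" using Cons.prems(2) z
      by (auto simp: tau_map_def split: if_splits)
    define t where "t = [0..<n][i - 1 := [0..<n] ! (j - 1), j - 1 := [0..<n] ! (i - 1)]"
    have t: "distinct t" "set t = {..<n}" using ij by (auto simp: t_def simp del: nth_upt)
    have *: "tau_map i j x = Some (map ((!) x) t)" if "length x = n" for x
      using tau_map_map[of i j "[0..<n]" "(!) x"] that ij map_nth[of x] by (simp add: t_def del: nth_upt)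
    obtain c1 where "computes B m n c1 (\<lambda>x. map ((!) (f0 x)) t)" "nodes c1 = nodes c"
      using computes_permute[OF Cons.prems(1) t] by auto
    then show ?thesis using that[of n c1 "\<lambda>x. map ((!) (f0 x)) t"] len * by (simp add: Swap)
  qed
  have "run_steps ss (f1 x) = Some (f x)" if "length x = m" for x
    using Cons.prems(3)[OF that] c1(3)[OF that] by simp
  then obtain n' c' where "computes B m n' c' f" "length (nodes c') \<le> length (nodes c1) + length ss"
    using Cons.IH[OF c1(1)] Cons.prems(2) by auto
  then show ?case using c1(2) by (intro exI[of _ n'] exI[of _ c']) auto
qed

lemma computes_id: "\<exists>c. computes B m m c (\<lambda>x. x) \<and> nodes c = []"
proof (intro exI conjI)
  have "map ((!) x) [0..<m] = x" if "length x = m" for x :: word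
    using that map_nth by blast
  then show "computes B m m \<lparr>nodes = [], outputs = [0..<m]\<rparr> (\<lambda>x. x)"
    by (simp add: computes_def wf_circuit_def eval_circuit_def lessThan_atLeast0)
qed simp

lemma steps_to_circuit:
  assumes "\<forall>g\<in>B. valid_gate g" "wf_steps B ss"
    "\<And>x. length x = m \<Longrightarrow> run_steps ss x = Some (f x)"
  shows "\<exists>n c. computes B m n c f \<and> length (nodes c) \<le> length ss"
proof -
  obtain c where "computes B m m c (\<lambda>x. x)" "nodes c = []" using computes_id by blast
  then show ?thesis using computes_run_steps[OF assms(1) _ assms(2), of m m c "\<lambda>x. x" f] assms(3)
    by simp
qed

section \<open>Compression to the touched wires\<close>

lemma nths_conv_map: "nths xs I = map ((!) xs) (filter (\<lambda>i. i \<in> I) [0..<length xs])"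
proof -
  have "zip xs [0..<length xs] = map (\<lambda>i. (xs ! i, i)) [0..<length xs]"
    by (intro nth_equalityI) auto
  then show ?thesis by (simp add: nths_def filter_map comp_def)
qed

text \<open>An untouched input wire \<open>p\<close> becomes the output wire \<open>q\<close> with \<open>M - p = N - q\<close>, since
  a gate shifts all wires behind its inputs by the same amount. The inequalities exclude truncated
  subtraction.\<close>

definition same_outside :: "nat \<Rightarrow> nat \<Rightarrow> nat set \<Rightarrow> nat set \<Rightarrow> bool" where
  "same_outside M N I J \<longleftrightarrow> I \<subseteq> {..<M} \<and> J \<subseteq> {..<N} \<and>
     (\<forall>p<M. p \<notin> I \<longrightarrow> M \<le> p + N \<and> p + N - M \<notin> J) \<and>
     (\<forall>q<N. q \<notin> J \<longrightarrow> N \<le> q + M \<and> q + M - N \<notin> I)"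

lemma same_outside_trans:
  assumes "same_outside M N I J" "same_outside N K J L"
  shows "same_outside M K I L"
proof -
  have "M \<le> p + K \<and> p + K - M \<notin> L" if p: "p < M" "p \<notin> I" for p
  proof -
    define q where "q = p + N - M"
    have q: "M \<le> p + N" "q \<notin> J" "q < N" using p assms(1) by (auto simp: same_outside_def q_def)
    then have "N \<le> q + K" "q + K - N \<notin> L" using assms(2) by (auto simp: same_outside_def)
    moreover have "q + K - N = p + K - M" using q by (simp add: q_def)
    ultimately show ?thesis using q by (simp add: q_def)
  qed
  moreover have "K \<le> r + M \<and> r + M - K \<notin> I" if r: "r < K" "r \<notin> L" for r
  proof -
    define q where "q = r + N - K"
    have q: "K \<le> r + N" "q \<notin> J" "q < N" using r assms(2) by (auto simp: same_outside_def q_def)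
    then have "N \<le> q + M" "q + M - N \<notin> I" using assms(1) by (auto simp: same_outside_def)
    moreover have "q + M - N = r + M - K" using q by (simp add: q_def)
    ultimately show ?thesis using q by (simp add: q_def)
  qed
  ultimately show ?thesis using assms by (auto simp: same_outside_def)
qed

text \<open>The shift is zero, so both sets have the same complement.\<close>

lemma same_outside_eq: "same_outside M M I J \<Longrightarrow> J = I"
  by (auto simp: same_outside_def)

text \<open>\<open>\<psi>\<close> receives only the selected wires, so the selected part of the
  output cannot depend on the others. Together with the last clause, \<open>\<phi>\<close> is, where
  defined, a map on the selected wires next to the identity on the rest.\<close>

definition compresses ::
    "nat \<Rightarrow> nat \<Rightarrow> (word \<rightharpoonup> word) \<Rightarrow> (word \<rightharpoonup> word) \<Rightarrow> nat set \<Rightarrow> nat set \<Rightarrow> bool" where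
  "compresses M N \<phi> \<psi> I J \<longleftrightarrow> same_outside M N I J \<and>
     (\<forall>x y. length x = M \<longrightarrow> \<phi> x = Some y \<longrightarrow>
       \<psi> (nths x I) = Some (nths y J) \<and> (\<forall>p<M. p \<notin> I \<longrightarrow> y ! (p + N - M) = x ! p))"

lemma compresses_comp:
  assumes 1: "compresses M K \<phi> \<psi> I J" and 2: "compresses K N \<phi>' \<psi>' J L"
    and K: "\<And>x y. length x = M \<Longrightarrow> \<phi> x = Some y \<Longrightarrow> length y = K"
  shows "compresses M N (\<lambda>x. Option.bind (\<phi> x) \<phi>') (\<lambda>x. Option.bind (\<psi> x) \<psi>') I L"
  unfolding compresses_def
proof (intro conjI allI impI)
  show "same_outside M N I L" using 1 2 same_outside_trans by (auto simp: compresses_def)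
  fix x y :: word
  assume x: "length x = M" and "Option.bind (\<phi> x) \<phi>' = Some y"
  then obtain w where w: "\<phi> x = Some w" "\<phi>' w = Some y" by (auto split: bind_splits)
  have lw: "length w = K" using K[OF x w(1)] .
  have a: "\<psi> (nths x I) = Some (nths w J)" "\<And>p. p < M \<Longrightarrow> p \<notin> I \<Longrightarrow> w ! (p + K - M) = x ! p"
    using 1 x w(1) unfolding compresses_def by blast+
  have b: "\<psi>' (nths w J) = Some (nths y L)" "\<And>p. p < K \<Longrightarrow> p \<notin> J \<Longrightarrow> y ! (p + N - K) = w ! p"
    using 2 lw w(2) unfolding compresses_def by blast+
  show "Option.bind (\<psi> (nths x I)) \<psi>' = Some (nths y L)" using a(1) b(1) by simp
  fix p assume p: "p < M" "p \<notin> I"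
  define q where "q = p + K - M"
  have q: "M \<le> p + K" "q \<notin> J" "q < K"
    using 1 p by (auto simp: compresses_def same_outside_def q_def)
  have "y ! (q + N - K) = x ! p" using b(2)[OF q(3,2)] a(2)[OF p] by (simp add: q_def)
  moreover have "q + N - K = p + N - M" using q by (simp add: q_def)
  ultimately show "y ! (p + N - M) = x ! p" by simp
qed

section \<open>Compressing a single step\<close>

text \<open>The transposition becomes that of the ranks of the two positions in the increasing list
  \<open>L\<close> of \<open>I\<close>.\<close>

lemma compress_swap:
  assumes "1 \<le> i" "i < j" "j \<le> M" "{i - 1, j - 1} \<subseteq> I" "I \<subseteq> {..<M}"
  shows "\<exists>s. wf_step B s \<and> (\<forall>x y. length x = M \<longrightarrow> tau_map i j x = Some y \<longrightarrow>
      step_map s (nths x I) = Some (nths y I) \<and> (\<forall>p<M. p \<notin> I \<longrightarrow> y ! p = x ! p))"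
proof -
  define L where "L = filter (\<lambda>i. i \<in> I) [0..<M]"
  have L: "distinct L" "set L = I" using assms(5) by (auto simp: L_def)
  have sL: "sorted L" unfolding L_def by (intro sorted_wrt_filter) simp
  obtain k where k: "k < length L" "L ! k = i - 1"
    using assms(4) L(2) by (metis in_set_conv_nth insert_subset)
  obtain l where l: "l < length L" "L ! l = j - 1"
    using assms(4) L(2) by (metis in_set_conv_nth insert_subset)
  \<comment> \<open>Ranks keep the order of the positions, so the new swap is well-formed.\<close>
  have kl: "k < l"
  proof (rule ccontr)
    assume "\<not> k < l"
    then have "L ! l \<le> L ! k" using sorted_nth_mono[OF sL] k(1) by simp
    then show False using k l assms(1,2) by simp
  qed
  show ?thesis
  proof (intro exI[of _ "Swap (k + 1) (l + 1)"] conjI allI impI)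
    fix x y :: word
    assume x: "length x = M" and "tau_map i j x = Some y"
    then have y: "y = x[i - 1 := x ! (j - 1), j - 1 := x ! (i - 1)]" and ly: "length y = M"
      using assms(3) by (auto simp: tau_map_def)
    have "map ((!) y) L = map ((!) x) (L[k := L ! l, l := L ! k])"
    proof (intro nth_equalityI)
      fix r assume "r < length (map ((!) y) L)"
      then have r: "r < length L" by simp
      have "L ! r < M" using r L(2) assms(5) nth_mem by blast
      moreover have "L ! r = i - 1 \<longleftrightarrow> r = k" "L ! r = j - 1 \<longleftrightarrow> r = l"
        using k l r L(1) nth_eq_iff_index_eq by metis+
      ultimately show "map ((!) y) L ! r = map ((!) x) (L[k := L ! l, l := L ! k]) ! r"
        using r k l x kl assms(1-3)
        by (cases "r = k"; cases "r = l") (simp_all add: y nth_list_update)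
    qed simp
    then show "step_map (Swap (k + 1) (l + 1)) (nths x I) = Some (nths y I)"
      using tau_map_map[of "k + 1" "l + 1" L "(!) x"] kl l(1) x ly
      by (simp add: nths_conv_map L_def[symmetric])
    show "y ! p = x ! p" if "p < M" "p \<notin> I" for p
    proof -
      have "p \<noteq> i - 1" "p \<noteq> j - 1" using that assms(4) by auto
      then show ?thesis by (simp add: y)
    qed
  qed (use kl in auto)
qed

lemma nths_take_all: "{..<a} \<subseteq> I \<Longrightarrow> nths (take a x) I = take a x"
  by (rule nths_all) auto

text \<open>A gate reads a front segment contained in \<open>I\<close>, which is therefore also the
  front of the selected word; the same gate applies. \<open>J\<close> consists of all outputs of the
  gate and of the shifted selected wires behind them.\<close>

lemma compress_gate:
  assumes "valid_gate g" "gate_ins g \<le> M" "{..<gate_ins g} \<subseteq> I" "I \<subseteq> {..<M}"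
  defines "N \<equiv> M - gate_ins g + gate_outs g"
  defines "J \<equiv> {q. q < gate_outs g \<or> q < N \<and> q - gate_outs g + gate_ins g \<in> I}"
  assumes "length x = M" "gate_map g x = Some y"
  shows "gate_map g (nths x I) = Some (nths y J)"
    and "\<forall>p<M. p \<notin> I \<longrightarrow> y ! (p + N - M) = x ! p"
proof -
  define a where "a = gate_ins g"
  define b where "b = gate_outs g"
  define K where "K = {j. j + a \<in> I}"
  have lu: "length (gate_fun g (take a x)) = b"
    using valid_gate_length[OF assms(1), of "take a x"] assms by (simp add: a_def b_def)
  have y: "y = gate_fun g (take a x) @ drop a x"
    using assms by (simp add: gate_map_def a_def)
  have "nths x I = nths (take a x @ drop a x) I" by simp
  also have "\<dots> = take a x @ nths (drop a x) K"
    using assms(2,3,7) nths_take_all[of a I x] by (simp only: nths_append) (simp add: K_def a_def)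
  finally have n: "nths x I = take a x @ nths (drop a x) K" .
  have "nths y J = gate_fun g (take a x) @ nths (drop a x) {j. j + b \<in> J}"
    unfolding y nths_append lu using lu by (simp add: nths_all J_def b_def)
  also have "nths (drop a x) {j. j + b \<in> J} = nths (drop a x) K"
    unfolding nths_conv_map using assms(2,7)
    by (intro arg_cong[of _ _ "map _"] filter_cong) (auto simp: J_def K_def a_def b_def N_def)
  finally show "gate_map g (nths x I) = Some (nths y J)"
    using n assms(2,7) by (simp add: gate_map_def a_def)
  show "\<forall>p<M. p \<notin> I \<longrightarrow> y ! (p + N - M) = x ! p"
  proof (intro allI impI)
    fix p assume "p < M" "p \<notin> I"
    then have "a \<le> p" using assms(3) by (auto simp: a_def not_less[symmetric])
    then have "p + N - M = p - a + b" using assms(2) by (simp add: N_def a_def b_def)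
    moreover have "y ! (p - a + b) = drop a x ! (p - a)"
      unfolding y nth_append lu by simp
    ultimately show "y ! (p + N - M) = x ! p" using \<open>a \<le> p\<close> \<open>p < M\<close> assms(7) by simp
  qed
qed

text \<open>\<open>J0\<close> is the set of wires that later steps demand; \<open>I0\<close> is its
  pullback, enlarged by the at most \<open>d\<close> wires that the step itself touches. For a
  larger \<open>I\<close> the output set \<open>J\<close> may grow too, so only
  \<open>J0 \<subseteq> J\<close> is promised.\<close>

lemma compress_step:
  assumes v: "\<forall>g\<in>B. valid_gate g" "\<forall>g\<in>B. gate_ins g \<le> d" "2 \<le> d" and s: "wf_step B s"
    and def: "\<forall>x. length x = M \<longrightarrow> (\<exists>y. length y = N \<and> step_map s x = Some y)"
    and J0: "J0 \<subseteq> {..<N}"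
  shows "\<exists>I0\<subseteq>{..<M}. card I0 \<le> d + card J0 \<and> (\<forall>I. I0 \<subseteq> I \<and> I \<subseteq> {..<M} \<longrightarrow>
    (\<exists>s' J. wf_step B s' \<and> J0 \<subseteq> J \<and> compresses M N (step_map s) (step_map s') I J))"
proof (cases s)
  case (Swap i j)
  have ij: "1 \<le> i" "i < j" "j \<le> M" "N = M"
    using s def[rule_format, of "replicate M False"] by (auto simp: Swap tau_map_def split: if_splits)
  show ?thesis
  proof (intro exI[of _ "{i - 1, j - 1} \<union> J0"] conjI allI impI)
    show "{i - 1, j - 1} \<union> J0 \<subseteq> {..<M}" using ij J0 by auto
    show "card ({i - 1, j - 1} \<union> J0) \<le> d + card J0"
      using card_Un_le[of "{i - 1, j - 1}" J0] ij assms(3) by auto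
    fix I assume I: "{i - 1, j - 1} \<union> J0 \<subseteq> I \<and> I \<subseteq> {..<M}"
    then obtain s' where "wf_step B s'" "\<And>x y. length x = M \<Longrightarrow> tau_map i j x = Some y \<Longrightarrow>
      step_map s' (nths x I) = Some (nths y I) \<and> (\<forall>p<M. p \<notin> I \<longrightarrow> y ! p = x ! p)"
      using compress_swap[OF ij(1-3), of I B] by auto
    then show "\<exists>s' J. wf_step B s' \<and> J0 \<subseteq> J \<and> compresses M N (step_map s) (step_map s') I J"
      using I by (intro exI[of _ s'] exI[of _ I]) (auto simp: Swap ij(4) same_outside_def compresses_def)
  qed
next
  case (Apply g)
  define a where "a = gate_ins g"
  define b where "b = gate_outs g"
  have g: "g \<in> B" "valid_gate g" using s v by (auto simp: Apply)
  have aM: "a \<le> M" and N: "N = M - a + b"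
    using s def[rule_format, of "replicate M False"] valid_gate_length[OF g(2)]
    by (auto simp: Apply gate_map_def a_def b_def split: if_splits)
  \<comment> \<open>Demanded wires that the gate produces are accounted for by its inputs; the
    others are shifted back to their positions before the gate.\<close>
  define I0 where "I0 = {..<a} \<union> (\<lambda>q. q - b + a) ` (J0 - {..<b})"
  have fJ: "finite J0" using J0 finite_subset by blast
  show ?thesis
  proof (intro exI[of _ I0] conjI allI impI)
    show "I0 \<subseteq> {..<M}" using J0 aM by (auto simp: I0_def N)
    have "card I0 \<le> card {..<a} + card (J0 - {..<b})"
      unfolding I0_def using card_Un_le card_image_le[of "J0 - {..<b}"] fJ
      by (meson add_left_mono finite_Diff order_trans)
    also have "\<dots> \<le> d + card J0"
      using card_mono[of J0 "J0 - {..<b}"] fJ v(2) g(1) by (intro add_mono) (auto simp: a_def)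
    finally show "card I0 \<le> d + card J0" .
    fix I assume I: "I0 \<subseteq> I \<and> I \<subseteq> {..<M}"
    define J where "J = {q. q < b \<or> q < N \<and> q - b + a \<in> I}"
    have aI: "{..<a} \<subseteq> I" using I by (auto simp: I0_def)
    have "J0 \<subseteq> J" using I J0 by (auto simp: J_def I0_def)
    moreover have "same_outside M N I J"
      unfolding same_outside_def
    proof (intro conjI allI impI)
      show "I \<subseteq> {..<M}" using I by simp
      show "J \<subseteq> {..<N}" using N by (auto simp: J_def)
      fix p assume p: "p < M" "p \<notin> I"
      then have "a \<le> p" using aI by (auto simp: not_less[symmetric])
      then have "p + N - M = p - a + b" using aM N by simp
      then show "M \<le> p + N" "p + N - M \<notin> J" using p \<open>a \<le> p\<close> aM N by (auto simp: J_def)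
    next
      fix q assume q: "q < N" "q \<notin> J"
      then have "b \<le> q" by (auto simp: J_def)
      then show "N \<le> q + M" "q + M - N \<notin> I" using q aM N by (auto simp: J_def)
    qed
    ultimately show "\<exists>s' J. wf_step B s' \<and> J0 \<subseteq> J \<and> compresses M N (step_map s) (step_map s') I J"
      using compress_gate[OF g(2) aM[unfolded a_def] aI[unfolded a_def] conjunct2[OF I]] s
      by (intro exI[of _ s] exI[of _ J]) (auto simp: Apply a_def b_def N J_def compresses_def)
  qed
qed

section \<open>Compressing whole programs\<close>

text \<open>The induction hypothesis comes first and tells what the tail demands after the first
  step; the first step pulls this set back. The clause about all larger \<open>I\<close> lets the
  pieces fit, since the set reached after the first step may exceed \<open>J0\<close>.\<close>

lemma compress_steps:
  assumes v: "\<forall>g\<in>B. valid_gate g" "\<forall>g\<in>B. gate_ins g \<le> d" "2 \<le> d" and "wf_steps B ss"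
    and "\<forall>x. length x = M \<longrightarrow> (\<exists>y. length y = N \<and> run_steps ss x = Some y)"
  shows "\<exists>I0\<subseteq>{..<M}. card I0 \<le> d * length ss \<and> (\<forall>I. I0 \<subseteq> I \<and> I \<subseteq> {..<M} \<longrightarrow>
    (\<exists>ss' J. wf_steps B ss' \<and> length ss' = length ss \<and> compresses M N (run_steps ss) (run_steps ss') I J))"
  using assms(4-)
proof (induction ss arbitrary: M)
  case Nil
  have N: "N = M" using Nil(2)[rule_format, of "replicate M False"] by simp
  have "compresses M N (run_steps []) (run_steps []) I I" if "I \<subseteq> {..<M}" for I
    using that by (auto simp: N same_outside_def compresses_def)
  then show ?case
    by (intro exI[of _ "{}"] conjI allI impI) (auto intro!: exI[of _ "[]"] simp del: run_steps.simps)
next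
  case (Cons s ss)
  define z where "z = replicate M False"
  have lz: "length z = M" by (simp add: z_def)
  obtain z1 zN where z1: "step_map s z = Some z1" "run_steps ss z1 = Some zN" "length zN = N"
    using Cons.prems(2)[rule_format, OF lz] by (auto split: bind_splits)
  define K where "K = length z1"
  have s: "\<forall>x. length x = M \<longrightarrow> (\<exists>y. length y = K \<and> step_map s x = Some y)"
    using step_map_length[OF v(1) _ z1(1)] Cons.prems(1) lz by (auto simp: K_def)
  have ss: "\<forall>x. length x = K \<longrightarrow> (\<exists>y. length y = N \<and> run_steps ss x = Some y)"
    using run_steps_length[OF v(1) _ z1(2)] Cons.prems(1) z1(3) by (auto simp: K_def)
  have wss: "wf_steps B ss" and ws: "wf_step B s" using Cons.prems(1) by simp_all
  from Cons.IH[OF wss ss] obtain J0 where J0: "J0 \<subseteq> {..<K}" "card J0 \<le> d * length ss" and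
    Jss: "\<forall>J. J0 \<subseteq> J \<and> J \<subseteq> {..<K} \<longrightarrow> (\<exists>ss' L. wf_steps B ss' \<and> length ss' = length ss \<and>
      compresses K N (run_steps ss) (run_steps ss') J L)"
    by (elim exE conjE)
  from compress_step[OF v ws s J0(1)] obtain I0 where I0: "I0 \<subseteq> {..<M}" "card I0 \<le> d + card J0"
    and Is: "\<forall>I. I0 \<subseteq> I \<and> I \<subseteq> {..<M} \<longrightarrow>
      (\<exists>s' J. wf_step B s' \<and> J0 \<subseteq> J \<and> compresses M K (step_map s) (step_map s') I J)"
    by (elim exE conjE)
  show ?case
  proof (intro exI[of _ I0] conjI allI impI)
    show "card I0 \<le> d * length (s # ss)" using I0(2) J0(2) by simp
    fix I assume "I0 \<subseteq> I \<and> I \<subseteq> {..<M}"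
    then obtain s' J where s': "wf_step B s'" "J0 \<subseteq> J" and
      1: "compresses M K (step_map s) (step_map s') I J" using Is by blast
    have "J \<subseteq> {..<K}" using 1 by (simp add: compresses_def same_outside_def)
    then obtain ss' L where ss': "wf_steps B ss'" "length ss' = length ss" and
      2: "compresses K N (run_steps ss) (run_steps ss') J L" using Jss s'(2) by blast
    have "length y = K" if "length x = M" "step_map s x = Some y" for x y
      using s that by fastforce
    then have "compresses M N (run_steps (s # ss)) (run_steps (s' # ss')) I L"
      using compresses_comp[OF 1 2] by (simp add: compresses_def)
    then show "\<exists>ss' J. wf_steps B ss' \<and> length ss' = length (s # ss) \<and>
        compresses M N (run_steps (s # ss)) (run_steps ss') I J"
      using s'(1) ss' by (intro exI[of _ "s' # ss'"] exI[of _ L]) auto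
  qed (rule I0(1))
qed

text \<open>For a length-preserving map the input and output selections coincide by
  \<open>same_outside_eq\<close>, so the compressed program again maps a bundle of selected wires to
  itself.\<close>

lemma compress:
  assumes v: "\<forall>g\<in>B. valid_gate g" "\<forall>g\<in>B. gate_ins g \<le> d" "2 \<le> d" and "wf_steps B ss"
    and run: "\<And>x. length x = M \<Longrightarrow> run_steps ss x = Some (f x)"
    and len: "\<And>x. length x = M \<Longrightarrow> length (f x) = M"
  obtains I0 where "I0 \<subseteq> {..<M}" "card I0 \<le> d * length ss"
    "\<And>x p. length x = M \<Longrightarrow> p < M \<Longrightarrow> p \<notin> I0 \<Longrightarrow> f x ! p = x ! p"
    "\<And>I. I0 \<subseteq> I \<Longrightarrow> I \<subseteq> {..<M} \<Longrightarrow> \<exists>ss'. wf_steps B ss' \<and> length ss' = length ss \<and>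
      (\<forall>x. length x = M \<longrightarrow> run_steps ss' (nths x I) = Some (nths (f x) I))"
proof -
  have "\<forall>x. length x = M \<longrightarrow> (\<exists>y. length y = M \<and> run_steps ss x = Some y)"
    using run len by simp
  from compress_steps[OF v assms(4) this] obtain I0 where I0: "I0 \<subseteq> {..<M}" "card I0 \<le> d * length ss"
    and *: "\<forall>I. I0 \<subseteq> I \<and> I \<subseteq> {..<M} \<longrightarrow> (\<exists>ss' J. wf_steps B ss' \<and> length ss' = length ss \<and>
      compresses M M (run_steps ss) (run_steps ss') I J)"
    by (elim exE conjE)
  have c: "\<exists>ss'. wf_steps B ss' \<and> length ss' = length ss \<and>
      compresses M M (run_steps ss) (run_steps ss') I I" if "I0 \<subseteq> I" "I \<subseteq> {..<M}" for I
  proof -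
    from *[rule_format, OF conjI[OF that]] obtain ss' J where ss': "wf_steps B ss'"
      "length ss' = length ss" "compresses M M (run_steps ss) (run_steps ss') I J"
      by (elim exE conjE)
    have "J = I" by (rule same_outside_eq[of M]) (use ss'(3) in \<open>simp add: compresses_def\<close>)
    then show ?thesis using ss' by (intro exI[of _ ss']) simp
  qed
  show ?thesis
  proof (rule that[OF I0])
    show "f x ! p = x ! p" if x: "length x = M" and "p < M" "p \<notin> I0" for x p
    proof -
      from c[OF order_refl I0(1)] obtain ss'
        where "compresses M M (run_steps ss) (run_steps ss') I0 I0" by (elim exE conjE)
      then show ?thesis using that run[OF x] by (simp add: compresses_def)
    qed
    fix I assume "I0 \<subseteq> I" "I \<subseteq> {..<M}"
    from c[OF this] obtain ss' where ss': "wf_steps B ss'" "length ss' = length ss"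
      "compresses M M (run_steps ss) (run_steps ss') I I" by (elim exE conjE)
    have "run_steps ss' (nths x I) = Some (nths (f x) I)" if "length x = M" for x
      using ss'(3) that run[OF that] by (simp add: compresses_def)
    then show "\<exists>ss'. wf_steps B ss' \<and> length ss' = length ss \<and>
      (\<forall>x. length x = M \<longrightarrow> run_steps ss' (nths x I) = Some (nths (f x) I))"
      using ss'(1,2) by (intro exI[of _ ss']) simp
  qed
qed

text \<open>Turns statements about selected words into statements about all words of length
  \<open>card I\<close>. Being false outside \<open>I\<close> makes two such preimages agree there,
  which is used to show that the map induced on the touched wires is injective.\<close>

lemma nths_surj:
  assumes "I \<subseteq> {..<M}" "length u = card I"
  obtains x where "length x = M" "nths x I = u" "\<And>p. p < M \<Longrightarrow> p \<notin> I \<Longrightarrow> \<not> x ! p"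
proof -
  define L where "L = filter (\<lambda>i. i \<in> I) [0..<M]"
  have L: "distinct L" "set L = I" using assms(1) by (auto simp: L_def)
  have lL: "length L = length u" using distinct_card[OF L(1)] L(2) assms(2) by simp
  define m where "m = map_of (zip L u)"
  \<comment> \<open>A position outside \<open>I\<close> is not a key of \<open>m\<close> and so
    receives \<open>False\<close>.\<close>
  define x where "x = map (\<lambda>p. m p = Some True) [0..<M]"
  have x: "x ! p = (m p = Some True)" "length x = M" if "p < M" for p using that by (auto simp: x_def)
  show ?thesis
  proof (rule that[of x])
    show lx: "length x = M" by (simp add: x_def)
    show "nths x I = u"
      unfolding nths_conv_map lx L_def[symmetric]
    proof (intro nth_equalityI)
      fix r assume "r < length (map ((!) x) L)"
      then have r: "r < length L" by simp
      then have "L ! r < M" using L(2) assms(1) nth_mem by blast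
      moreover have "m (L ! r) = Some (u ! r)"
        unfolding m_def using map_of_zip_nth[OF lL L(1)] lL r by simp
      ultimately show "map ((!) x) L ! r = u ! r" using r x by simp
    qed (use lL in simp)
    show "\<not> x ! p" if "p < M" "p \<notin> I" for p
    proof -
      have "m p = None" using that(2) L(2) lL by (simp add: m_def map_of_zip_is_None)
      then show ?thesis using x(1)[OF that(1)] by simp
    qed
  qed
qed

section \<open>Maximal extensions and the monoid \<open>lepM21\<close>\<close>

text \<open>For a finitely generated domain this is essentiality in a form that is easy to compose;
  see \<open>maximal_prefix_code_covers\<close> and \<open>essential_fg_covers\<close>.\<close>

definition cofinal :: "(word \<rightharpoonup> word) \<Rightarrow> bool" where
  "cofinal \<phi> \<longleftrightarrow> ri_hom \<phi> \<and> (\<exists>m. \<forall>x. m \<le> length x \<longrightarrow> x \<in> dom \<phi>)"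

definition eventually_equal :: "(word \<rightharpoonup> word) \<Rightarrow> (word \<rightharpoonup> word) \<Rightarrow> bool" where
  "eventually_equal \<phi> \<psi> \<longleftrightarrow> (\<exists>m. \<forall>x. m \<le> length x \<longrightarrow> \<phi> x = \<psi> x)"

lemma ri_hom_append: "ri_hom \<phi> \<Longrightarrow> \<phi> x = Some y \<Longrightarrow> \<phi> (x @ z) = Some (y @ z)"
  unfolding ri_hom_def by (metis domI option.sel)

lemma ri_homI:
  assumes "\<And>x y z. \<phi> x = Some y \<Longrightarrow> \<phi> (x @ z) = Some (y @ z)"
  shows "ri_hom \<phi>"
proof -
  have "\<forall>x\<in>dom \<phi>. \<forall>z. \<phi> (x @ z) = Some (the (\<phi> x) @ z)" using assms by auto
  then show ?thesis by (auto simp: ri_hom_def right_ideal_def)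
qed

text \<open>Explicit form of the maximal essential extension. It reads \<open>\<phi>\<close> only on
  long words, hence is invariant under \<open>eventually_equal\<close>.\<close>

definition eventual_ext :: "(word \<rightharpoonup> word) \<Rightarrow> (word \<rightharpoonup> word)" where
  "eventual_ext \<phi> x = (if \<exists>y m. \<forall>z. m \<le> length z \<longrightarrow> \<phi> (x @ z) = Some (y @ z)
     then Some (SOME y. \<exists>m. \<forall>z. m \<le> length z \<longrightarrow> \<phi> (x @ z) = Some (y @ z)) else None)"

lemma eventual_ext_iff: "eventual_ext \<phi> x = Some y \<longleftrightarrow> (\<exists>m. \<forall>z. m \<le> length z \<longrightarrow> \<phi> (x @ z) = Some (y @ z))"
proof -
  define P where "P y \<longleftrightarrow> (\<exists>m. \<forall>z. m \<le> length z \<longrightarrow> \<phi> (x @ z) = Some (y @ z))" for y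
  \<comment> \<open>Two candidates are compared at one suffix that is long enough for both, and the
    suffix cancels.\<close>
  have uniq: "y = y'" if P: "P y" "P y'" for y y'
  proof -
    obtain m m' where "\<forall>z. m \<le> length z \<longrightarrow> \<phi> (x @ z) = Some (y @ z)"
      "\<forall>z. m' \<le> length z \<longrightarrow> \<phi> (x @ z) = Some (y' @ z)" using P unfolding P_def by blast
    then have "Some (y @ replicate (max m m') True) = Some (y' @ replicate (max m m') True)"
      by (metis length_replicate max.cobounded1 max.cobounded2)
    then show ?thesis by simp
  qed
  have c: "eventual_ext \<phi> x = (if \<exists>y. P y then Some (SOME y. P y) else None)"
    by (simp add: eventual_ext_def P_def)
  have "eventual_ext \<phi> x = Some y \<longleftrightarrow> P y"
  proof (cases "\<exists>y. P y")
    case True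
    then have "P (SOME y. P y)" by (rule someI_ex)
    then show ?thesis using c uniq True by auto
  qed (use c in auto)
  then show ?thesis by (simp add: P_def)
qed

lemma eventual_ext_extends: "ri_hom \<phi> \<Longrightarrow> \<phi> x = Some y \<Longrightarrow> eventual_ext \<phi> x = Some y"
  unfolding eventual_ext_iff using ri_hom_append by blast

lemma ri_hom_eventual_ext: "ri_hom (eventual_ext \<phi>)"
proof (rule ri_homI)
  fix x y z assume "eventual_ext \<phi> x = Some y"
  then obtain m where m: "\<And>z. m \<le> length z \<Longrightarrow> \<phi> (x @ z) = Some (y @ z)"
    by (auto simp: eventual_ext_iff)
  show "eventual_ext \<phi> (x @ z) = Some (y @ z)"
    unfolding eventual_ext_iff using m[of "z @ w" for w] by (intro exI[of _ m]) auto
qed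

lemma cofinal_eventual_ext: "cofinal \<phi> \<Longrightarrow> cofinal (eventual_ext \<phi>)"
  unfolding cofinal_def using ri_hom_eventual_ext eventual_ext_extends by (metis domD domI)

lemma eventually_equal_sym: "eventually_equal \<phi> \<psi> \<Longrightarrow> eventually_equal \<psi> \<phi>"
  unfolding eventually_equal_def by metis

lemma eventual_ext_cong:
  assumes "eventually_equal \<phi> \<psi>"
  shows "eventual_ext \<phi> = eventual_ext \<psi>"
proof -
  have *: "eventual_ext \<psi> x = Some y"
    if eq: "eventually_equal \<phi> \<psi>" and cl: "eventual_ext \<phi> x = Some y" for \<phi> \<psi> :: "word \<rightharpoonup> word" and x y
  proof -
    obtain m where m: "\<forall>z. m \<le> length z \<longrightarrow> \<phi> (x @ z) = Some (y @ z)"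
      using cl unfolding eventual_ext_iff by blast
    obtain k where k: "\<forall>x. k \<le> length x \<longrightarrow> \<phi> x = \<psi> x"
      using eq unfolding eventually_equal_def by blast
    have "\<psi> (x @ z) = Some (y @ z)" if "max m k \<le> length z" for z
      using m[rule_format, of z] k[rule_format, of "x @ z"] that by simp
    then show ?thesis unfolding eventual_ext_iff by blast
  qed
  have "eventually_equal \<psi> \<phi>" using assms by (rule eventually_equal_sym)
  then have "eventual_ext \<phi> x = Some y \<longleftrightarrow> eventual_ext \<psi> x = Some y" for x y using * assms by blast
  then show ?thesis by (metis ext not_Some_eq)
qed

lemma eventually_equal_eventual_ext:
  assumes "cofinal \<phi>"
  shows "eventually_equal \<phi> (eventual_ext \<phi>)"
  using assms eventual_ext_extends unfolding cofinal_def eventually_equal_def by (metis domD)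

text \<open>If \<open>\<Theta>\<close> is an essential extension defined at \<open>x\<close>, then
  \<open>\<phi>\<close> maps \<open>x @ z\<close> to the value of \<open>\<Theta>\<close> at
  \<open>x\<close> followed by \<open>z\<close>, for all long \<open>z\<close>; so
  \<open>\<Theta>\<close> lies below \<open>eventual_ext \<phi>\<close>. The latter is thus the
  greatest essential extension, and the description operator in \<open>max_ext\<close> picks
  it.\<close>

lemma max_ext_eq_eventual_ext:
  assumes "cofinal \<phi>"
  shows "max_ext \<phi> = eventual_ext \<phi>"
proof -
  have hom: "ri_hom \<phi>" using assms by (simp add: cofinal_def)
  obtain m where m: "\<And>x. m \<le> length x \<Longrightarrow> x \<in> dom \<phi>" using assms by (auto simp: cofinal_def)
  have le: "\<Theta> \<subseteq>\<^sub>m eventual_ext \<phi>" if "essential_extension \<Theta> \<phi>" for \<Theta>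
  proof (unfold map_le_def, intro ballI)
    fix x assume "x \<in> dom \<Theta>"
    then obtain y where y: "\<Theta> x = Some y" by auto
    have "\<phi> (x @ z) = Some (y @ z)" if z: "m \<le> length z" for z
    proof -
      have "x @ z \<in> dom \<phi>" using m[of "x @ z"] z by simp
      then have "\<phi> (x @ z) = \<Theta> (x @ z)"
        using \<open>essential_extension \<Theta> \<phi>\<close> by (auto simp: essential_extension_def map_le_def)
      then show ?thesis
        using \<open>essential_extension \<Theta> \<phi>\<close> y ri_hom_append by (auto simp: essential_extension_def)
    qed
    then have "eventual_ext \<phi> x = Some y" by (auto simp: eventual_ext_iff)
    then show "\<Theta> x = eventual_ext \<phi> x" using y by simp
  qed
  have ext: "\<phi> \<subseteq>\<^sub>m eventual_ext \<phi>" using eventual_ext_extends[OF hom] by (auto simp: map_le_def dom_def)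
  have "essential_in (dom \<phi>) (dom (eventual_ext \<phi>))"
    unfolding essential_in_def
  proof (intro conjI allI impI)
    show "dom \<phi> \<subseteq> dom (eventual_ext \<phi>)" using ext map_le_implies_dom_le by blast
    fix S assume S: "right_ideal S \<and> dom (eventual_ext \<phi>) \<inter> S \<noteq> {}"
    then obtain s where "s \<in> S" by auto
    then have "s @ replicate m True \<in> S" using S by (auto simp: right_ideal_def)
    moreover have "s @ replicate m True \<in> dom \<phi>" by (rule m) simp
    ultimately show "dom \<phi> \<inter> S \<noteq> {}" by blast
  qed
  then have ess: "essential_extension (eventual_ext \<phi>) \<phi>"
    using hom ri_hom_eventual_ext ext by (simp add: essential_extension_def)
  show ?thesis unfolding max_ext_def
  proof (rule the_equality)
    show "essential_extension (eventual_ext \<phi>) \<phi> \<and>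
      (\<forall>\<Theta>. essential_extension \<Theta> \<phi> \<and> eventual_ext \<phi> \<subseteq>\<^sub>m \<Theta> \<longrightarrow> \<Theta> = eventual_ext \<phi>)"
      using ess le map_le_antisym by blast
    show "\<Psi> = eventual_ext \<phi>" if "essential_extension \<Psi> \<phi> \<and>
      (\<forall>\<Theta>. essential_extension \<Theta> \<phi> \<and> \<Psi> \<subseteq>\<^sub>m \<Theta> \<longrightarrow> \<Theta> = \<Psi>)" for \<Psi>
      using that ess le by blast
  qed
qed

lemma eventually_equal_trans [trans]:
  assumes "eventually_equal \<phi> \<psi>" "eventually_equal \<psi> \<theta>"
  shows "eventually_equal \<phi> \<theta>"
proof -
  obtain m n where "\<forall>x. m \<le> length x \<longrightarrow> \<phi> x = \<psi> x" "\<forall>x. n \<le> length x \<longrightarrow> \<psi> x = \<theta> x"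
    using assms by (auto simp: eventually_equal_def)
  then have "\<forall>x. max m n \<le> length x \<longrightarrow> \<phi> x = \<theta> x" by simp
  then show ?thesis unfolding eventually_equal_def by blast
qed

text \<open>Reduces equality in the monoid to comparing representatives on long words.\<close>

lemma max_ext_eq_iff:
  assumes "cofinal \<phi>" "cofinal \<psi>"
  shows "max_ext \<phi> = max_ext \<psi> \<longleftrightarrow> eventually_equal \<phi> \<psi>"
  using assms eventual_ext_cong eventually_equal_eventual_ext eventually_equal_sym eventually_equal_trans
  by (metis max_ext_eq_eventual_ext)

lemma eventually_equal_max_ext: "cofinal \<phi> \<Longrightarrow> eventually_equal \<phi> (max_ext \<phi>)"
  using eventually_equal_eventual_ext max_ext_eq_eventual_ext by simp

lemma cofinal_max_ext: "cofinal \<phi> \<Longrightarrow> cofinal (max_ext \<phi>)"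
  using cofinal_eventual_ext max_ext_eq_eventual_ext by simp

text \<open>Past its first \<open>m\<close> letters a word is copied, so it loses at most
  \<open>m\<close> letters. Long words stay long, which is why composites are again cofinal.\<close>

lemma cofinal_length:
  assumes "cofinal \<phi>"
  obtains m where "\<And>x. m \<le> length x \<Longrightarrow> \<exists>y. \<phi> x = Some y \<and> length x \<le> length y + m"
proof -
  obtain m where m: "\<And>x. m \<le> length x \<Longrightarrow> x \<in> dom \<phi>" using assms by (auto simp: cofinal_def)
  have "\<exists>y. \<phi> x = Some y \<and> length x \<le> length y + m" if x: "m \<le> length x" for x
  proof -
    obtain u where u: "\<phi> (take m x) = Some u" using m[of "take m x"] x by auto
    have "\<phi> (take m x @ drop m x) = Some (u @ drop m x)"
      using assms u by (intro ri_hom_append) (auto simp: cofinal_def)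
    then show ?thesis by simp
  qed
  then show ?thesis using that by blast
qed

lemma ri_hom_comp: "ri_hom \<phi> \<Longrightarrow> ri_hom \<psi> \<Longrightarrow> ri_hom (\<phi> \<circ>\<^sub>m \<psi>)"
  by (rule ri_homI) (auto simp: map_comp_Some_iff ri_hom_append)

lemma cofinal_comp:
  assumes "cofinal \<phi>" "cofinal \<psi>"
  shows "cofinal (\<phi> \<circ>\<^sub>m \<psi>)"
proof -
  obtain m where m: "\<And>x. m \<le> length x \<Longrightarrow> \<exists>y. \<phi> x = Some y \<and> length x \<le> length y + m"
    using cofinal_length[OF assms(1)] by blast
  obtain n where n: "\<And>x. n \<le> length x \<Longrightarrow> \<exists>y. \<psi> x = Some y \<and> length x \<le> length y + n"
    using cofinal_length[OF assms(2)] by blast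
  have "x \<in> dom (\<phi> \<circ>\<^sub>m \<psi>)" if x: "m + n \<le> length x" for x
  proof -
    obtain y where y: "\<psi> x = Some y" "length x \<le> length y + n" using n[of x] x by auto
    moreover obtain w where "\<phi> y = Some w" using m[of y] x y by auto
    ultimately show ?thesis by auto
  qed
  then show ?thesis using assms ri_hom_comp unfolding cofinal_def by blast
qed

lemma eventually_equal_comp:
  assumes "eventually_equal \<phi> \<phi>'" "eventually_equal \<psi> \<psi>'" "cofinal \<psi>"
  shows "eventually_equal (\<phi> \<circ>\<^sub>m \<psi>) (\<phi>' \<circ>\<^sub>m \<psi>')"
proof -
  obtain n where n: "\<And>x. n \<le> length x \<Longrightarrow> \<exists>y. \<psi> x = Some y \<and> length x \<le> length y + n"
    using cofinal_length[OF assms(3)] by blast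
  obtain k l where k: "\<And>x. k \<le> length x \<Longrightarrow> \<phi> x = \<phi>' x" and l: "\<And>x. l \<le> length x \<Longrightarrow> \<psi> x = \<psi>' x"
    using assms by (auto simp: eventually_equal_def)
  have "(\<phi> \<circ>\<^sub>m \<psi>) x = (\<phi>' \<circ>\<^sub>m \<psi>') x" if x: "n + k + l \<le> length x" for x
  proof -
    obtain y where y: "\<psi> x = Some y" "length x \<le> length y + n" using n[of x] x by auto
    then have "\<phi> y = \<phi>' y" "\<psi>' x = Some y" using k[of y] l[of x] x by auto
    then show ?thesis using y by (simp add: map_comp_def)
  qed
  then show ?thesis unfolding eventually_equal_def by blast
qed

lemma max_ext_mult:
  assumes "cofinal \<phi>" "cofinal \<psi>"
  shows "max_ext (max_ext \<phi> \<circ>\<^sub>m max_ext \<psi>) = max_ext (\<phi> \<circ>\<^sub>m \<psi>)"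
  using assms
  by (subst max_ext_eq_iff) (auto intro!: cofinal_comp cofinal_max_ext eventually_equal_comp
      intro: eventually_equal_sym[OF eventually_equal_max_ext])

lemma cofinal_Some: "cofinal Some"
  by (auto simp: cofinal_def intro: ri_homI)

lemma max_ext_Some: "max_ext Some = Some"
proof -
  have "eventual_ext Some x = Some x" for x by (simp add: eventual_ext_iff)
  then show ?thesis using max_ext_eq_eventual_ext[OF cofinal_Some] by auto
qed

section \<open>Representatives with images of uniform length\<close>

text \<open>Replaces the prefix codes in the definition of \<open>lepM21\<close>: one level with
  images of one length determines \<open>\<phi>\<close> on all longer words and makes every higher
  level uniform too.\<close>

definition level_map :: "(word \<rightharpoonup> word) \<Rightarrow> nat \<Rightarrow> nat \<Rightarrow> bool" where
  "level_map \<phi> m n \<longleftrightarrow> ri_hom \<phi> \<and> (\<forall>x. length x = m \<longrightarrow> (\<exists>y. \<phi> x = Some y \<and> length y = n))"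

lemma level_map_pad:
  assumes "level_map \<phi> m n"
  shows "level_map \<phi> (m + k) (n + k)"
  unfolding level_map_def
proof (intro conjI allI impI)
  show hom: "ri_hom \<phi>" using assms by (simp add: level_map_def)
  fix x :: word assume x: "length x = m + k"
  then have "length (take m x) = m" by simp
  then obtain u where u: "\<phi> (take m x) = Some u" "length u = n"
    using assms unfolding level_map_def by blast
  then have "\<phi> (take m x @ drop m x) = Some (u @ drop m x)" using hom ri_hom_append by blast
  then show "\<exists>y. \<phi> x = Some y \<and> length y = n + k" using u x by simp
qed

lemma level_map_cofinal:
  assumes "level_map \<phi> m n"
  shows "cofinal \<phi>"
proof -
  have "x \<in> dom \<phi>" if "m \<le> length x" for x
    using level_map_pad[OF assms, of "length x - m"] that by (auto simp: level_map_def)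
  then show ?thesis using assms by (auto simp: cofinal_def level_map_def)
qed

lemma level_map_comp:
  assumes "level_map \<phi> m n" "level_map \<psi> k l"
  shows "\<exists>i j. level_map (\<phi> \<circ>\<^sub>m \<psi>) i j"
proof -
  have "level_map \<psi> (k + m) (l + m)" "level_map \<phi> (m + l) (n + l)"
    using assms level_map_pad by auto
  then have "level_map (\<phi> \<circ>\<^sub>m \<psi>) (k + m) (n + l)"
    unfolding level_map_def using ri_hom_comp by (fastforce simp: map_comp_Some_iff add.commute)
  then show ?thesis by blast
qed

text \<open>A word at least as long as all of \<open>P\<close> and without prefix in
  \<open>P\<close> could be added to the code, against maximality.\<close>

lemma maximal_prefix_code_covers:
  fixes P :: "word set"
  assumes "finite P" "maximal_prefix_code P"
  obtains m where "\<And>x. m \<le> length x \<Longrightarrow> x \<in> ideal_of P"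
proof
  fix x :: word assume x: "Max (insert 0 (length ` P)) \<le> length x"
  have len: "length p \<le> length x" if "p \<in> P" for p
    using that x assms(1) by (meson Max_ge finite_imageI finite_insert imageI insertI2 order_trans)
  show "x \<in> ideal_of P"
  proof (rule ccontr)
    assume no: "x \<notin> ideal_of P"
    have np: "\<not> prefix p x" if "p \<in> P" for p using no that by (auto simp: ideal_of_def prefix_def)
    have np': "\<not> prefix x p" if "p \<in> P" for p
    proof
      assume "prefix x p"
      then have "x = p" using len[OF that] by (auto simp: prefix_def)
      then show False using np[OF that] by simp
    qed
    have "prefix_code (insert x P)"
      using np np' assms(2) by (auto simp: prefix_code_def maximal_prefix_code_def)
    moreover have "x \<notin> P" using np by auto
    ultimately show False using assms(2) unfolding maximal_prefix_code_def by blast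
  qed
qed

lemma ideal_of_words: "ideal_of (words m) = {x. m \<le> length x}"
proof -
  have "x = take m x @ drop m x" for x :: word by simp
  then show ?thesis unfolding ideal_of_def words_def
    by (auto simp: min_def) (metis append_take_drop_id length_take min.absorb2)
qed

lemma finite_words: "finite (words m)"
  using finite_lists_length_eq[of "UNIV :: bool set" m] by (simp add: words_def)

lemma maximal_prefix_code_words: "maximal_prefix_code (words m)"
proof -
  have "prefix_code (words m)" by (auto simp: prefix_code_def prefix_def)
  moreover have "\<not> words m \<subset> P" if P: "prefix_code P" for P
  proof
    assume s: "words m \<subset> P"
    then obtain x where "x \<in> P" "x \<notin> words m" by blast
    then have x: "x \<in> P" "length x \<noteq> m" by simp_all
    \<comment> \<open>\<open>x\<close> cut or padded to length \<open>m\<close>, hence an element of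
      \<open>words m\<close> that is prefix-comparable with \<open>x\<close>.\<close>
    define u where "u = take m x @ replicate (m - length x) True"
    have u: "u \<in> words m" by (simp add: u_def)
    have "prefix u x \<or> prefix x u" by (cases "m \<le> length x") (auto simp: u_def take_is_prefix)
    moreover have "u \<in> P" using s u by blast
    ultimately have "u = x" using P x(1) unfolding prefix_code_def by blast
    then show False using u x(2) by simp
  qed
  ultimately show ?thesis by (simp add: maximal_prefix_code_def)
qed

lemma carrier_lepM21: "carrier lepM21 = {max_ext \<phi> | \<phi>. \<exists>m n. level_map \<phi> m n}"
proof (intro equalityI subsetI)
  fix g assume "g \<in> carrier lepM21"
  then obtain \<phi> P Q where g: "g = max_ext \<phi>" and P: "finite P" "maximal_prefix_code P"
    and \<phi>: "ri_hom_between \<phi> (ideal_of P) (ideal_of Q)"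
      "\<forall>x\<^sub>1\<in>dom \<phi>. \<forall>x\<^sub>2\<in>dom \<phi>. length x\<^sub>1 = length x\<^sub>2 \<longrightarrow>
         length (the (\<phi> x\<^sub>1)) = length (the (\<phi> x\<^sub>2))"
    by (auto simp: lepM21_def)
  obtain m where m: "\<And>x. m \<le> length x \<Longrightarrow> x \<in> ideal_of P"
    using maximal_prefix_code_covers[OF P] by blast
  have dom: "x \<in> dom \<phi>" if "m \<le> length x" for x using m[OF that] \<phi> by (simp add: ri_hom_between_def)
  \<comment> \<open>The common output length is read off at one arbitrary word of length
    \<open>m\<close>.\<close>
  have "level_map \<phi> m (length (the (\<phi> (replicate m True))))"
    unfolding level_map_def
  proof (intro conjI allI impI)
    show "ri_hom \<phi>" using \<phi> by (simp add: ri_hom_between_def)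
    fix x :: word assume x: "length x = m"
    have d: "x \<in> dom \<phi>" "replicate m True \<in> dom \<phi>" using dom x by simp_all
    have "length x = length (replicate m True)" using x by simp
    then have "length (the (\<phi> x)) = length (the (\<phi> (replicate m True)))"
      using \<phi>(2) d by blast
    moreover obtain y where "\<phi> x = Some y" using d by blast
    ultimately show "\<exists>y. \<phi> x = Some y \<and> length y = length (the (\<phi> (replicate m True)))" by simp
  qed
  then show "g \<in> {max_ext \<phi> | \<phi>. \<exists>m n. level_map \<phi> m n}" using g by blast
next
  fix g assume "g \<in> {max_ext \<phi> | \<phi>. \<exists>m n. level_map \<phi> m n}"
  then obtain \<phi> m n where g: "g = max_ext \<phi>" and lev: "level_map \<phi> m n" by auto
  \<comment> \<open>Cut down to long words, the domain is the ideal of the maximal prefix code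
    \<open>words m\<close>; the code \<open>{[]}\<close>, which generates all words, serves as
    \<open>Q\<close>.\<close>
  define \<psi> where "\<psi> = \<phi> |` {x. m \<le> length x}"
  have \<phi>x: "\<exists>y. \<phi> x = Some y \<and> length y = n + (length x - m)" if "m \<le> length x" for x
    using level_map_pad[OF lev, of "length x - m"] that by (auto simp: level_map_def)
  have dom: "dom \<psi> = {x. m \<le> length x}" using \<phi>x unfolding \<psi>_def dom_restrict by blast
  have hom: "ri_hom \<phi>" using lev by (simp add: level_map_def)
  have hom': "ri_hom \<psi>"
    by (rule ri_homI) (use hom in \<open>auto simp: \<psi>_def restrict_map_def ri_hom_append split: if_splits\<close>)
  have "max_ext \<psi> = max_ext \<phi>"
  proof (subst max_ext_eq_iff)
    show "cofinal \<psi>" using dom hom' by (auto simp: cofinal_def)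
    show "cofinal \<phi>" using lev level_map_cofinal by blast
    show "eventually_equal \<psi> \<phi>" unfolding eventually_equal_def \<psi>_def
      by (intro exI[of _ m]) (simp add: restrict_map_def)
  qed
  moreover have "ri_hom_between \<psi> (ideal_of (words m)) (ideal_of {[]})"
    using dom hom' ideal_of_words[of m] unfolding ri_hom_between_def ideal_of_def[of "{[]}"] by auto
  moreover have "length (the (\<psi> x)) = n + (length x - m)" if "x \<in> dom \<psi>" for x
    using \<phi>x[of x] that unfolding dom by (auto simp: \<psi>_def)
  then have "\<forall>x\<^sub>1\<in>dom \<psi>. \<forall>x\<^sub>2\<in>dom \<psi>. length x\<^sub>1 = length x\<^sub>2 \<longrightarrow>
         length (the (\<psi> x\<^sub>1)) = length (the (\<psi> x\<^sub>2))"
    by (metis (no_types))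
  moreover have "prefix_code {[]}" by (simp add: prefix_code_def)
  ultimately show "g \<in> carrier lepM21"
    unfolding lepM21_def using g finite_words maximal_prefix_code_words
    by simp (metis finite.emptyI finite_insert)
qed

lemma mult_lepM21: "mult lepM21 = (\<lambda>\<phi> \<psi>. max_ext (\<phi> \<circ>\<^sub>m \<psi>))"
  by (simp add: lepM21_def M21_def)

lemma one_lepM21: "one lepM21 = Some"
  by (simp add: lepM21_def M21_def)

lemma map_comp_assoc: "(f \<circ>\<^sub>m g) \<circ>\<^sub>m h = f \<circ>\<^sub>m (g \<circ>\<^sub>m h)"
  by (auto simp: map_comp_def split: option.splits)

lemma map_comp_Some [simp]: "f \<circ>\<^sub>m Some = f" "Some \<circ>\<^sub>m f = f"
  by (auto simp: map_comp_def split: option.splits)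

lemma lepM21_cases:
  assumes "g \<in> carrier lepM21"
  obtains \<phi> m n where "g = max_ext \<phi>" "level_map \<phi> m n" "cofinal \<phi>"
  using assms level_map_cofinal by (auto simp: carrier_lepM21)

interpretation lepM21: monoid lepM21
proof (rule monoidI)
  show "x \<otimes>\<^bsub>lepM21\<^esub> y \<in> carrier lepM21" if "x \<in> carrier lepM21" "y \<in> carrier lepM21" for x y
    using that by (elim lepM21_cases) (auto simp: mult_lepM21 max_ext_mult carrier_lepM21 level_map_comp)
  have "level_map Some 0 0" by (auto simp: level_map_def intro: ri_homI)
  then show "\<one>\<^bsub>lepM21\<^esub> \<in> carrier lepM21"
    unfolding carrier_lepM21 one_lepM21 using max_ext_Some by (metis (mono_tags, lifting) mem_Collect_eq)
  show "x \<otimes>\<^bsub>lepM21\<^esub> y \<otimes>\<^bsub>lepM21\<^esub> z = x \<otimes>\<^bsub>lepM21\<^esub> (y \<otimes>\<^bsub>lepM21\<^esub> z)"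
    if "x \<in> carrier lepM21" "y \<in> carrier lepM21" "z \<in> carrier lepM21" for x y z
    using that by (elim lepM21_cases) (simp add: mult_lepM21 max_ext_mult cofinal_comp map_comp_assoc)
  show "\<one>\<^bsub>lepM21\<^esub> \<otimes>\<^bsub>lepM21\<^esub> x = x" "x \<otimes>\<^bsub>lepM21\<^esub> \<one>\<^bsub>lepM21\<^esub> = x" if "x \<in> carrier lepM21" for x
    using that max_ext_mult[OF cofinal_Some] max_ext_mult[OF _ cofinal_Some]
    by (auto simp: mult_lepM21 one_lepM21 max_ext_Some elim!: lepM21_cases)
qed

section \<open>Words over the generators\<close>

lemma run_steps_Cons: "run_steps (s # ss) = run_steps ss \<circ>\<^sub>m step_map s"
  by (rule ext) (auto simp: map_comp_def split: option.splits)

lemma level_map_step: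
  assumes "\<forall>g\<in>B. valid_gate g" "wf_step B s"
  shows "\<exists>m n. level_map (step_map s) m n"
proof -
  have hom: "ri_hom (step_map s)" by (rule ri_homI) (rule step_map_append[OF assms(2)])
  obtain m x y where xy: "length x = m" "step_map s x = Some y"
  proof (cases s)
    case (Apply g)
    then show ?thesis using that[of "replicate (gate_ins g) True"] by (simp add: gate_map_def)
  next
    case (Swap i j)
    then show ?thesis using that[of "replicate j True"] by (simp add: tau_map_def)
  qed
  have "\<exists>y'. step_map s x' = Some y' \<and> length y' = length y" if "length x' = m" for x'
    using step_map_length[OF assms xy(2)] that xy(1) by simp
  then have "level_map (step_map s) m (length y)"
    using hom by (simp add: level_map_def)
  then show ?thesis by blast
qed

lemma level_map_Some: "level_map Some 0 0"
  by (auto simp: level_map_def intro: ri_homI)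

lemma level_map_run_steps:
  assumes "\<forall>g\<in>B. valid_gate g" "wf_steps B ss"
  shows "\<exists>m n. level_map (run_steps ss) m n"
  using assms(2)
proof (induction ss)
  case Nil
  have "run_steps [] = Some" by auto
  then show ?case using level_map_Some by auto
next
  case (Cons s ss)
  then show ?case using level_map_step[OF assms(1), of s] level_map_comp
    unfolding run_steps_Cons by (metis list.set_intros(1) list.set_intros(2))
qed

lemma cofinal_step:
  "\<forall>g\<in>B. valid_gate g \<Longrightarrow> wf_step B s \<Longrightarrow> cofinal (step_map s)"
  using level_map_step level_map_cofinal by blast

lemma cofinal_run_steps:
  "\<forall>g\<in>B. valid_gate g \<Longrightarrow> wf_steps B ss \<Longrightarrow> cofinal (run_steps ss)"
  using level_map_run_steps level_map_cofinal by blast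

context monoid
begin

lemma word_product_Cons [simp]: "word_product G (x # xs) = x \<otimes> word_product G xs"
  and word_product_Nil [simp]: "word_product G [] = \<one>"
  by (simp_all add: word_product_def)

lemma word_product_closed [simp]: "set xs \<subseteq> carrier G \<Longrightarrow> word_product G xs \<in> carrier G"
  by (induction xs) auto

lemma word_product_append:
  "set xs \<subseteq> carrier G \<Longrightarrow> set ys \<subseteq> carrier G \<Longrightarrow>
    word_product G (xs @ ys) = word_product G xs \<otimes> word_product G ys"
  by (induction xs) (auto simp: m_assoc)

end

lemma step_element_closed:
  "\<forall>g\<in>B. valid_gate g \<Longrightarrow> wf_step B s \<Longrightarrow> max_ext (step_map s) \<in> carrier lepM21"
  unfolding carrier_lepM21 using level_map_step by blast

text \<open>Products compose from right to left, programs run from left to right: the first step is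
  the last factor.\<close>

lemma word_product_steps:
  assumes "\<forall>g\<in>B. valid_gate g" "wf_steps B ss"
  shows "word_product lepM21 (rev (map (\<lambda>s. max_ext (step_map s)) ss)) = max_ext (run_steps ss)"
  using assms(2)
proof (induction ss)
  case Nil
  have "run_steps [] = Some" by auto
  then show ?case by (simp add: lepM21.word_product_Nil one_lepM21 max_ext_Some)
next
  case (Cons s ss)
  have c: "max_ext (step_map s) \<in> carrier lepM21"
    "set (rev (map (\<lambda>s. max_ext (step_map s)) ss)) \<subseteq> carrier lepM21"
    using step_element_closed[OF assms(1)] Cons.prems by auto
  have "word_product lepM21 (rev (map (\<lambda>s. max_ext (step_map s)) (s # ss))) =
      max_ext (run_steps ss) \<otimes>\<^bsub>lepM21\<^esub> max_ext (step_map s)"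
    using c Cons by (simp add: lepM21.word_product_append)
  also have "\<dots> = max_ext (run_steps (s # ss))"
    using max_ext_mult cofinal_run_steps[OF assms(1)] cofinal_step[OF assms(1)] Cons.prems
    unfolding run_steps_Cons mult_lepM21 by simp
  finally show ?case .
qed

definition circuit_generators :: "gate set \<Rightarrow> (word \<rightharpoonup> word) set" where
  "circuit_generators B = gate_elements B \<union> bit_transpositions"

lemma circuit_generators_eq: "circuit_generators B = {max_ext (step_map s) | s. wf_step B s}"
proof (intro equalityI subsetI)
  fix x assume "x \<in> circuit_generators B"
  then consider g where "g \<in> B" "x = max_ext (gate_map g)"
    | i j where "1 \<le> i" "i < j" "x = max_ext (tau_map i j)"
    unfolding circuit_generators_def gate_elements_def bit_transpositions_def by blast
  then show "x \<in> {max_ext (step_map s) | s. wf_step B s}"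
  proof cases
    case 1
    then have "x = max_ext (step_map (Apply g))" "wf_step B (Apply g)" by simp_all
    then show ?thesis by blast
  next
    case 2
    then have "x = max_ext (step_map (Swap i j))" "wf_step B (Swap i j)" by simp_all
    then show ?thesis by blast
  qed
next
  fix x assume "x \<in> {max_ext (step_map s) | s. wf_step B s}"
  then obtain s where s: "x = max_ext (step_map s)" "wf_step B s" by blast
  then show "x \<in> circuit_generators B"
    unfolding circuit_generators_def gate_elements_def bit_transpositions_def by (cases s) auto
qed

lemma circuit_word:
  assumes "ws \<in> lists (circuit_generators B)"
  shows "\<exists>ss. wf_steps B ss \<and> ws = rev (map (\<lambda>s. max_ext (step_map s)) ss)"
  using assms
proof (induction ws)
  case (Cons w ws)
  then obtain s ss where "w = max_ext (step_map s)" "wf_step B s" "wf_steps B ss"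
    "ws = rev (map (\<lambda>s. max_ext (step_map s)) ss)"
    unfolding circuit_generators_eq by blast
  then show ?case by (intro exI[of _ "ss @ [s]"]) auto
qed simp

text \<open>Length is kept in both directions, so word length and serial complexity become minima
  over the same set of numbers.\<close>

lemma circuit_word_iff:
  assumes B: "\<forall>g\<in>B. valid_gate g" and "cofinal \<phi>"
  shows "(\<exists>ws\<in>lists (circuit_generators B). word_product lepM21 ws = max_ext \<phi> \<and> length ws = n) \<longleftrightarrow>
    (\<exists>ss. wf_steps B ss \<and> eventually_equal (run_steps ss) \<phi> \<and> length ss = n)" (is "?L \<longleftrightarrow> ?R")
proof
  assume ?L
  then obtain ws where ws: "ws \<in> lists (circuit_generators B)" "word_product lepM21 ws = max_ext \<phi>"
    "length ws = n" by blast
  obtain ss where ss: "wf_steps B ss" "ws = rev (map (\<lambda>s. max_ext (step_map s)) ss)"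
    using circuit_word[OF ws(1)] by blast
  have "max_ext (run_steps ss) = max_ext \<phi>" using word_product_steps[OF B ss(1)] ws(2) ss(2) by simp
  then have "eventually_equal (run_steps ss) \<phi>"
    using max_ext_eq_iff[OF cofinal_run_steps[OF B ss(1)] assms(2)] by simp
  then show ?R using ss ws(3) by auto
next
  assume ?R
  then obtain ss where ss: "wf_steps B ss" "eventually_equal (run_steps ss) \<phi>" "length ss = n" by blast
  have "rev (map (\<lambda>s. max_ext (step_map s)) ss) \<in> lists (circuit_generators B)"
    using ss(1) unfolding circuit_generators_eq in_lists_conv_set by fastforce
  moreover have "word_product lepM21 (rev (map (\<lambda>s. max_ext (step_map s)) ss)) = max_ext \<phi>"
    using word_product_steps[OF B ss(1)] ss(2)
      max_ext_eq_iff[OF cofinal_run_steps[OF B ss(1)] assms(2)] by simp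
  ultimately show ?L using ss(3) by (intro bexI) auto
qed

section \<open>Functions on words of fixed length as monoid elements\<close>

text \<open>Only the values of \<open>f\<close> on \<open>words m\<close> enter, whatever
  \<open>f\<close> does elsewhere.\<close>

definition lift :: "nat \<Rightarrow> (word \<Rightarrow> word) \<Rightarrow> (word \<rightharpoonup> word)" where
  "lift m f x = (if m \<le> length x then Some (f (take m x) @ drop m x) else None)"

lemma lift_append: "length x = m \<Longrightarrow> lift m f (x @ z) = Some (f x @ z)"
  by (simp add: lift_def)

lemma ri_hom_lift: "ri_hom (lift m f)"
  by (rule ri_homI) (auto simp: lift_def split: if_splits)

lemma cofinal_lift: "cofinal (lift m f)"
  unfolding cofinal_def using ri_hom_lift by (auto simp: lift_def intro!: exI[of _ m])

lemma eventually_equal_on_words: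
  assumes "ri_hom \<phi>" "ri_hom \<psi>" "\<And>x. length x = m \<Longrightarrow> \<exists>y. \<phi> x = Some y \<and> \<psi> x = Some y"
  shows "eventually_equal \<phi> \<psi>"
  unfolding eventually_equal_def
proof (intro exI[of _ m] allI impI)
  fix x :: word assume "m \<le> length x"
  then have "length (take m x) = m" by simp
  then obtain y where "\<phi> (take m x) = Some y" "\<psi> (take m x) = Some y" using assms(3) by blast
  then have "\<phi> (take m x @ drop m x) = \<psi> (take m x @ drop m x)"
    using ri_hom_append assms(1,2) by metis
  then show "\<phi> x = \<psi> x" by simp
qed

lemma ri_hom_run_steps: "wf_steps B ss \<Longrightarrow> ri_hom (run_steps ss)"
  by (rule ri_homI) (rule run_steps_extend)

text \<open>Borrowed wires are the slack in agreement on long words: the bundle size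
  \<open>M\<close> plays the part of the threshold in \<open>eventually_equal\<close>.\<close>

lemma serial_computes_iff:
  "serial_computes B m ss f \<longleftrightarrow> wf_steps B ss \<and> eventually_equal (run_steps ss) (lift m f)"
proof (cases "wf_steps B ss")
  case True
  have "(\<exists>M\<ge>m. \<forall>x\<in>words M. run_steps ss x = Some (f (take m x) @ drop m x)) \<longleftrightarrow>
      eventually_equal (run_steps ss) (lift m f)" (is "?L \<longleftrightarrow> ?R")
  proof
    assume ?L
    then obtain M where M: "m \<le> M" "\<forall>x\<in>words M. run_steps ss x = Some (f (take m x) @ drop m x)"
      by blast
    show ?R
      by (rule eventually_equal_on_words[of _ _ M]) (use M ri_hom_lift ri_hom_run_steps[OF True] in \<open>auto simp: lift_def\<close>)
  next
    assume ?R
    then obtain k where k: "\<forall>x. k \<le> length x \<longrightarrow> run_steps ss x = lift m f x"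
      unfolding eventually_equal_def by blast
    show ?L by (rule exI[of _ "max m k"]) (use k in \<open>auto simp: lift_def\<close>)
  qed
  then show ?thesis using True by (simp add: serial_computes_def)
next
  case False
  then show ?thesis unfolding serial_computes_def by blast
qed

lemma word_length_lift:
  assumes "\<forall>g\<in>B. valid_gate g"
  shows "word_length lepM21 (circuit_generators B) (max_ext (lift m f)) = serial_complexity B m f"
  unfolding word_length_def serial_complexity_def circuit_word_iff[OF assms cofinal_lift] serial_computes_iff
  by (simp add: conj_assoc)

text \<open>The bound is at least 2 so that it also covers the transpositions, which touch two
  wires.\<close>

lemma gate_ins_bounded:
  assumes "finite B"
  obtains d where "\<forall>g\<in>B. gate_ins g \<le> d" "2 \<le> d"
proof
  show "\<forall>g\<in>B. gate_ins g \<le> Max (insert 2 (gate_ins ` B))" "2 \<le> Max (insert 2 (gate_ins ` B))"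
    using assms by simp_all
qed

lemma circuit_generators_generate:
  assumes "finite B" "universal B"
  shows "generates lepM21 (circuit_generators B)"
  unfolding generates_def
proof (intro conjI equalityI subsetI)
  have B: "\<forall>g\<in>B. valid_gate g" using assms by (simp add: universal_def)
  show c: "g \<in> carrier lepM21" if "g \<in> circuit_generators B" for g
    using that step_element_closed[OF B] by (auto simp: circuit_generators_eq)
  show "g \<in> carrier lepM21" if g: "g \<in> word_product lepM21 ` lists (circuit_generators B)" for g
  proof -
    obtain ws where ws: "ws \<in> lists (circuit_generators B)" "g = word_product lepM21 ws" using g by blast
    then have "set ws \<subseteq> carrier lepM21" using c by auto
    then show ?thesis using ws(2) by (simp add: lepM21.word_product_closed)
  qed
  fix g assume "g \<in> carrier lepM21"
  then obtain \<phi> m n where g: "g = max_ext \<phi>" "level_map \<phi> m n" "cofinal \<phi>" by (rule lepM21_cases)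
  \<comment> \<open>Universality concerns positive numbers of ports, while \<open>m\<close> or
    \<open>n\<close> may be 0; the level is raised by one.\<close>
  have lev: "level_map \<phi> (m + 1) (n + 1)" using g(2) by (rule level_map_pad)
  define f where "f x = the (\<phi> x)" for x
  have "f ` words (m + 1) \<subseteq> words (n + 1)" using lev by (fastforce simp: f_def level_map_def)
  then obtain c where c: "computes B (m + 1) (n + 1) c f"
    using assms(2) unfolding universal_def by (metis add_gr_0 zero_less_one)
  obtain d where d: "\<forall>g\<in>B. gate_ins g \<le> d" "2 \<le> d" using gate_ins_bounded[OF assms(1)] .
  obtain ss where ss: "wf_steps B ss" "\<forall>x\<in>words (m + 1). run_steps ss x = Some (f x)"
    using circuit_to_steps[OF B d c] by blast
  have "eventually_equal (run_steps ss) \<phi>"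
  proof (rule eventually_equal_on_words)
    show "ri_hom (run_steps ss)" using ri_hom_run_steps[OF ss(1)] .
    show "ri_hom \<phi>" using g(2) by (simp add: level_map_def)
    fix x :: word assume x: "length x = m + 1"
    then obtain y where "\<phi> x = Some y" using lev unfolding level_map_def by blast
    then show "\<exists>y. run_steps ss x = Some y \<and> \<phi> x = Some y" using ss(2) x by (simp add: f_def)
  qed
  then have "\<exists>ws\<in>lists (circuit_generators B). word_product lepM21 ws = max_ext \<phi> \<and> length ws = length ss"
    using circuit_word_iff[OF B g(3)] ss(1) by blast
  then obtain ws where "ws \<in> lists (circuit_generators B)" "word_product lepM21 ws = max_ext \<phi>" by blast
  then show "g \<in> word_product lepM21 ` lists (circuit_generators B)"
    using g(1) by (intro image_eqI[of _ _ ws]) simp_all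
qed

section \<open>The group \<open>lpG21\<close> and its inverses\<close>

text \<open>The ideal of all extensions of a long word \<open>x\<close> meets
  \<open>ideal_of P\<close> in some \<open>x @ z = p @ w\<close>; as \<open>p\<close> is not longer
  than \<open>x\<close>, it is a prefix of \<open>x\<close>.\<close>

lemma essential_fg_covers:
  assumes "finite P" "essential (ideal_of P)"
  obtains m where "\<And>x. m \<le> length x \<Longrightarrow> x \<in> ideal_of P"
proof
  fix x :: word assume x: "Max (insert 0 (length ` P)) \<le> length x"
  have "right_ideal {x @ z | z. True}" by (auto simp: right_ideal_def)
  then have "ideal_of P \<inter> {x @ z | z. True} \<noteq> {}" using assms(2) unfolding essential_def by blast
  then obtain y where "y \<in> ideal_of P" "y \<in> {x @ z | z. True}" by blast
  then obtain z p w where p: "p \<in> P" "x @ z = p @ w" by (auto simp: ideal_of_def)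
  have "length p \<le> length x"
    using p(1) x assms(1) by (meson Max_ge finite_imageI finite_insert imageI insertI2 order_trans)
  then have "x = p @ drop (length p) x" using p(2) by (metis append_eq_append_conv_if append_take_drop_id)
  then show "x \<in> ideal_of P" using p(1) unfolding ideal_of_def by blast
qed

lemma essential_long_words: "essential {x. m \<le> length x}"
  unfolding essential_def
proof (intro conjI allI impI)
  show "right_ideal {x. m \<le> length x}" by (auto simp: right_ideal_def)
  fix S :: "word set" assume S: "right_ideal S \<and> S \<noteq> {}"
  then obtain s where "s \<in> S" by blast
  then have "s @ replicate m True \<in> S" using S by (auto simp: right_ideal_def)
  then show "{x. m \<le> length x} \<inter> S \<noteq> {}" by force
qed

lemma lpG21_eq: "lpG21 = {max_ext (lift m f) | m f. 0 < m \<and> bij_betw f (words m) (words m)}"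
proof (intro equalityI subsetI)
  fix g assume "g \<in> lpG21"
  then obtain \<phi> P S where g: "g = max_ext \<phi>" and R: "finite P" "essential (ideal_of P)"
    and iso: "ri_iso_between \<phi> (ideal_of P) S"
    and lp: "\<forall>x\<in>dom g. length (the (g x)) = length x"
    unfolding lpG21_def G21_def fg_right_ideal_def by blast
  have hom: "ri_hom \<phi>" "dom \<phi> = ideal_of P" "inj_on \<phi> (dom \<phi>)"
    using iso by (auto simp: ri_iso_between_def)
  obtain k where k: "\<And>x. k \<le> length x \<Longrightarrow> x \<in> ideal_of P" using essential_fg_covers[OF R] by blast
  \<comment> \<open>\<open>Suc\<close> makes the number of wires positive.\<close>
  define m where "m = Suc k"
  have cof: "cofinal \<phi>" using hom k by (auto simp: cofinal_def)
  have \<phi>: "\<exists>y. \<phi> x = Some y \<and> length y = length x" if "m \<le> length x" for x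
  proof -
    have "k \<le> length x" using that by (simp add: m_def)
    then have "x \<in> dom \<phi>" using k hom(2) by simp
    then obtain y where y: "\<phi> x = Some y" by blast
    \<comment> \<open>Length preservation is known for the maximal extension \<open>g\<close>, which
      agrees with \<open>\<phi>\<close> where \<open>\<phi>\<close> is defined.\<close>
    then have "g x = Some y" using eventual_ext_extends[OF hom(1)] by (simp add: g max_ext_eq_eventual_ext[OF cof])
    then show ?thesis using lp y by force
  qed
  define f where "f x = the (\<phi> x)" for x
  have f: "\<phi> x = Some (f x)" "length (f x) = m" if "length x = m" for x
    using \<phi>[of x] that by (auto simp: f_def)
  have "inj_on f (words m)"
  proof (rule inj_onI)
    fix x y assume xy: "x \<in> words m" "y \<in> words m" "f x = f y"
    then have "\<phi> x = \<phi> y" using f by simp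
    then show "x = y" using hom(3) f xy by (meson domI in_words inj_onD)
  qed
  moreover have "f ` words m \<subseteq> words m" using f by auto
  ultimately have "bij_betw f (words m) (words m)"
    using finite_words endo_inj_surj by (metis bij_betw_def)
  moreover have "eventually_equal \<phi> (lift m f)"
    by (rule eventually_equal_on_words[of _ _ m]) (use hom ri_hom_lift f in \<open>auto simp: lift_def\<close>)
  then have "g = max_ext (lift m f)" using max_ext_eq_iff[OF cof cofinal_lift] g by simp
  ultimately show "g \<in> {max_ext (lift m f) | m f. 0 < m \<and> bij_betw f (words m) (words m)}"
    by (auto simp: m_def)
next
  fix g assume "g \<in> {max_ext (lift m f) | m f. 0 < m \<and> bij_betw f (words m) (words m)}"
  then obtain m f where g: "g = max_ext (lift m f)" and f: "bij_betw f (words m) (words m)" by blast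
  define R where "R = {x :: word. m \<le> length x}"
  have len: "length (f x) = m" if "length x = m" for x using bij_betw_apply[OF f, of x] that by simp
  have R: "fg_right_ideal R" "essential R"
    using finite_words[of m] ideal_of_words[of m] essential_long_words
    unfolding fg_right_ideal_def R_def by blast+
  have dom: "dom (lift m f) = R" by (auto simp: lift_def R_def split: if_splits)
  have lp: "length y = length x" if "lift m f x = Some y" for x y
    using that len[of "take m x"] by (auto simp: lift_def split: if_splits)
  have "ran (lift m f) = R"
  proof (intro equalityI subsetI)
    fix y assume "y \<in> ran (lift m f)"
    then obtain x where "lift m f x = Some y" by (auto simp: ran_def)
    then show "y \<in> R" using lp dom by (auto simp: R_def)
  next
    fix y assume y: "y \<in> R"
    then have "take m y \<in> f ` words m" using f by (simp add: bij_betw_def R_def)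
    then obtain u where "length u = m" "f u = take m y" by auto
    then have "lift m f (u @ drop m y) = Some y" by (simp add: lift_append)
    then show "y \<in> ran (lift m f)" by (rule ranI)
  qed
  moreover have "inj_on (lift m f) R"
  proof (rule inj_onI)
    fix x y assume xy: "x \<in> R" "y \<in> R" "lift m f x = lift m f y"
    then have l: "length (take m x) = m" "length (take m y) = m" by (auto simp: R_def)
    have "f (take m x) @ drop m x = f (take m y) @ drop m y" using xy by (auto simp: lift_def R_def)
    then have "f (take m x) = f (take m y)" "drop m x = drop m y" using len l by auto
    moreover have "take m x = take m y"
      by (rule inj_onD[OF bij_betw_imp_inj_on[OF f] calculation(1)]) (use l in simp_all)
    ultimately show "x = y" by (metis append_take_drop_id)
  qed
  ultimately have "ri_iso_between (lift m f) R R"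
    using dom ri_hom_lift by (simp add: ri_iso_between_def)
  then have "g \<in> G21" using R g unfolding G21_def by blast
  \<comment> \<open>\<open>g\<close> may be defined on words shorter than \<open>m\<close>, where
    \<open>lift m f\<close> is not; lengths are compared after appending a common suffix.\<close>
  moreover have "length (the (g x)) = length x" if x: "x \<in> dom g" for x
  proof -
    obtain y where y: "g x = Some y" using x by auto
    then obtain k where "\<forall>z. k \<le> length z \<longrightarrow> lift m f (x @ z) = Some (y @ z)"
      unfolding g max_ext_eq_eventual_ext[OF cofinal_lift] eventual_ext_iff by blast
    then have "lift m f (x @ replicate k True) = Some (y @ replicate k True)" by simp
    then have "length y = length x" using lp by fastforce
    then show ?thesis using y by simp
  qed
  ultimately show "g \<in> lpG21" by (simp add: lpG21_def)
qed

lemma level_map_lift: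
  assumes "bij_betw f (words m) (words m)"
  shows "level_map (lift m f) m m"
  using assms bij_betwE ri_hom_lift by (fastforce simp: level_map_def lift_def)

lemma lift_comp:
  assumes "f ` words m \<subseteq> words m" "\<And>x. length x = m \<Longrightarrow> f' (f x) = x"
  shows "max_ext (lift m f') \<otimes>\<^bsub>lepM21\<^esub> max_ext (lift m f) = \<one>\<^bsub>lepM21\<^esub>"
proof -
  have "eventually_equal (lift m f' \<circ>\<^sub>m lift m f) Some"
  proof (rule eventually_equal_on_words[of _ _ m])
    show "ri_hom (lift m f' \<circ>\<^sub>m lift m f)" by (intro ri_hom_comp ri_hom_lift)
    show "ri_hom Some" by (auto intro: ri_homI)
    fix x :: word assume x: "length x = m"
    then have "length (f x) = m" using assms(1) by (metis image_subset_iff in_words)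
    then show "\<exists>y. (lift m f' \<circ>\<^sub>m lift m f) x = Some y \<and> Some x = Some y"
      using assms(2)[OF x] x by (simp add: lift_def map_comp_def)
  qed
  then have "max_ext (lift m f' \<circ>\<^sub>m lift m f) = max_ext Some"
    using max_ext_eq_iff cofinal_comp cofinal_lift cofinal_Some by blast
  then show ?thesis
    by (simp add: mult_lepM21 one_lepM21 max_ext_mult cofinal_lift max_ext_Some)
qed

lemma (in monoid) inv_unique_inverse:
  assumes "x \<in> carrier G" "y \<in> carrier G" "x \<otimes> y = \<one>" "y \<otimes> x = \<one>"
  shows "inv x = y"
  unfolding m_inv_def using assms inv_unique by (intro the_equality) auto

lemma inv_lift:
  assumes "bij_betw f (words m) (words m)"
  shows "inv\<^bsub>lepM21\<^esub> (max_ext (lift m f)) = max_ext (lift m (inv_into (words m) f))"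
proof (rule lepM21.inv_unique_inverse)
  define f' where "f' = inv_into (words m) f"
  have f': "bij_betw f' (words m) (words m)" unfolding f'_def using assms by (rule bij_betw_inv_into)
  show "max_ext (lift m f) \<in> carrier lepM21" "max_ext (lift m f') \<in> carrier lepM21"
    unfolding carrier_lepM21 using level_map_lift assms f' by blast+
  show "max_ext (lift m f) \<otimes>\<^bsub>lepM21\<^esub> max_ext (lift m f') = \<one>\<^bsub>lepM21\<^esub>"
    using assms f' by (intro lift_comp) (auto simp: f'_def bij_betw_def f_inv_into_f)
  show "max_ext (lift m f') \<otimes>\<^bsub>lepM21\<^esub> max_ext (lift m f) = \<one>\<^bsub>lepM21\<^esub>"
    using assms by (intro lift_comp) (auto simp: f'_def bij_betw_def inv_into_f_f)
qed

text \<open>Both suprema are taken over the very same set, which gives equality and not just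
  equivalence.\<close>

lemma serial_asymmetry_eq:
  assumes "\<forall>g\<in>B. valid_gate g"
  shows "serial_asymmetry B = word_length_asymmetry lepM21 lpG21 (circuit_generators B)"
proof
  fix n
  let ?wl = "word_length lepM21 (circuit_generators B)"
  have "{?wl (inv\<^bsub>lepM21\<^esub> g) | g. g \<in> lpG21 \<and> ?wl g \<le> n} =
     {serial_complexity B m (inv_into (words m) f) | m f.
       0 < m \<and> bij_betw f (words m) (words m) \<and> serial_complexity B m f \<le> n}" (is "?L = ?R")
  proof (intro equalityI subsetI)
    fix k assume "k \<in> ?L"
    then obtain m f where "k = ?wl (inv\<^bsub>lepM21\<^esub> (max_ext (lift m f)))" "?wl (max_ext (lift m f)) \<le> n"
      "0 < m" "bij_betw f (words m) (words m)" unfolding lpG21_eq by blast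
    then show "k \<in> ?R" by (auto simp: inv_lift word_length_lift[OF assms])
  next
    fix k assume "k \<in> ?R"
    then obtain m f where f: "k = serial_complexity B m (inv_into (words m) f)"
      "0 < m" "bij_betw f (words m) (words m)" "serial_complexity B m f \<le> n" by blast
    then have "k = ?wl (inv\<^bsub>lepM21\<^esub> (max_ext (lift m f)))" "?wl (max_ext (lift m f)) \<le> n"
      by (simp_all add: inv_lift word_length_lift[OF assms])
    then show "k \<in> ?L" using f(2,3) unfolding lpG21_eq by blast
  qed
  then show "serial_asymmetry B n = word_length_asymmetry lepM21 lpG21 (circuit_generators B) n"
    by (simp add: serial_asymmetry_def asymmetry_def word_length_asymmetry_def)
qed

section \<open>Asymmetry functions and linear domination\<close>

context monoid
begin

lemma word_length_le:
  "ws \<in> lists S \<Longrightarrow> word_length G S (word_product G ws) \<le> length ws"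
  unfolding word_length_def by (rule Least_le) blast

lemma word_length_attained:
  assumes "generates G S" "x \<in> carrier G"
  obtains ws where "ws \<in> lists S" "word_product G ws = x" "length ws = word_length G S x"
proof -
  have "x \<in> word_product G ` lists S" using assms by (simp add: generates_def)
  then have "\<exists>n. \<exists>ws\<in>lists S. word_product G ws = x \<and> length ws = n" by blast
  then have "\<exists>ws\<in>lists S. word_product G ws = x \<and> length ws = word_length G S x"
    unfolding word_length_def by (rule LeastI_ex)
  then show ?thesis using that by blast
qed

text \<open>Letters are replaced one by one: a letter of the shared, possibly infinite set
  \<open>T\<close> keeps length 1, and the finitely many letters of \<open>S'\<close> have bounded
  length over the other generators.\<close>

lemma word_length_compare:
  assumes g1: "generates G (S \<union> T)" and g2: "generates G (S' \<union> T)" and "finite S'"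
  obtains c where "0 < c" "\<And>x. x \<in> carrier G \<Longrightarrow> word_length G (S \<union> T) x \<le> c * word_length G (S' \<union> T) x"
proof -
  \<comment> \<open>The entry 1 covers the letters of \<open>T\<close> and keeps \<open>c\<close>
    positive.\<close>
  define c where "c = Max (insert 1 (word_length G (S \<union> T) ` S'))"
  have c: "1 \<le> c" "\<And>s. s \<in> S' \<Longrightarrow> word_length G (S \<union> T) s \<le> c"
    using assms(3) by (auto simp: c_def)
  have sub: "S' \<union> T \<subseteq> carrier G" "S \<union> T \<subseteq> carrier G" using g1 g2 by (auto simp: generates_def)
  have letter: "\<exists>vs\<in>lists (S \<union> T). word_product G vs = s \<and> length vs \<le> c" if s: "s \<in> S' \<union> T" for s
  proof (cases "s \<in> T")
    case True
    then show ?thesis using c(1) sub by (intro bexI[of _ "[s]"]) auto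
  next
    case False
    obtain ws where "ws \<in> lists (S \<union> T)" "word_product G ws = s" "length ws = word_length G (S \<union> T) s"
      using word_length_attained[OF g1, of s] s sub by blast
    then show ?thesis using c(2)[of s] False s by (intro bexI[of _ ws]) auto
  qed
  have word: "\<exists>vs\<in>lists (S \<union> T). word_product G vs = word_product G ws \<and> length vs \<le> c * length ws"
    if "ws \<in> lists (S' \<union> T)" for ws
    using that
  proof (induction ws)
    case (Cons w ws)
    obtain us where us: "us \<in> lists (S \<union> T)" "word_product G us = w" "length us \<le> c"
      using letter[OF Cons.hyps(1)] by blast
    obtain vs where vs: "vs \<in> lists (S \<union> T)" "word_product G vs = word_product G ws"
      "length vs \<le> c * length ws" using Cons.IH by blast
    have "set us \<subseteq> carrier G" "set vs \<subseteq> carrier G" using us(1) vs(1) sub by auto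
    then have "word_product G (us @ vs) = word_product G (w # ws)"
      using us vs by (simp add: word_product_append)
    then show ?case using us vs by (intro bexI[of _ "us @ vs"]) auto
  qed (auto intro: bexI[of _ "[]"])
  show ?thesis
  proof (rule that[of c])
    fix x assume "x \<in> carrier G"
    then obtain ws where ws: "ws \<in> lists (S' \<union> T)" "word_product G ws = x"
      "length ws = word_length G (S' \<union> T) x" using word_length_attained[OF g2] by blast
    obtain vs where "vs \<in> lists (S \<union> T)" "word_product G vs = x" "length vs \<le> c * length ws"
      using word[OF ws(1)] ws(2) by blast
    then show "word_length G (S \<union> T) x \<le> c * word_length G (S' \<union> T) x"
      using word_length_le[of vs "S \<union> T"] ws(3) by simp
  qed (use c in simp)
qed

end

section \<open>Suprema and linear domination\<close>

lemma nat_Sup_le: "(\<And>x. x \<in> X \<Longrightarrow> x \<le> b) \<Longrightarrow> Sup X \<le> (b :: nat)"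
  by (cases "X = {}") (auto simp: Sup_nat_def[of "{}"] intro: cSup_least)

definition lin_le :: "(nat \<Rightarrow> nat) \<Rightarrow> (nat \<Rightarrow> nat) \<Rightarrow> bool" where
  "lin_le f g \<longleftrightarrow> (\<exists>c\<^sub>0>0. \<exists>c>0. \<forall>n\<ge>c\<^sub>0. f n \<le> c * g (c * n))"

lemma lin_leI:
  assumes "0 < c\<^sub>0" "0 < c" "\<And>n. c\<^sub>0 \<le> n \<Longrightarrow> f n \<le> c * g (c * n)"
  shows "lin_le f g"
  unfolding lin_le_def using assms by blast

lemma lin_le_trans:
  assumes "lin_le f g" "lin_le g h"
  shows "lin_le f h"
proof -
  obtain a c where a: "0 < a" "0 < c" "\<And>n. a \<le> n \<Longrightarrow> f n \<le> c * g (c * n)"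
    using assms(1) unfolding lin_le_def by blast
  obtain b d where b: "0 < b" "0 < d" "\<And>n. b \<le> n \<Longrightarrow> g n \<le> d * h (d * n)"
    using assms(2) unfolding lin_le_def by blast
  have "f n \<le> (c * d) * h (c * d * n)" if n: "max a b \<le> n" for n
  proof -
    \<comment> \<open>As \<open>c\<close> is at least 1, the inner argument \<open>c * n\<close>
      also passes the threshold \<open>b\<close>.\<close>
    have "n \<le> c * n" using a(2) by simp
    moreover have "b \<le> n" using n by simp
    ultimately have "b \<le> c * n" by (rule order_trans[rotated])
    have "f n \<le> c * g (c * n)" using a(3) n by simp
    also have "\<dots> \<le> c * (d * h (d * (c * n)))" by (intro mult_le_mono2 b(3)) fact
    finally show ?thesis by (simp only: ac_simps)
  qed
  then show ?thesis using a b by (intro lin_leI[of "max a b" "c * d"]) simp_all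
qed

lemma lin_equivI:
  assumes "lin_le f g" "lin_le g f"
  shows "f \<simeq>\<^sub>l\<^sub>i\<^sub>n g"
proof -
  obtain a c where a: "0 < a" "0 < c" "\<And>n. a \<le> n \<Longrightarrow> f n \<le> c * g (c * n)"
    using assms(1) unfolding lin_le_def by blast
  obtain b d where b: "0 < b" "0 < d" "\<And>n. b \<le> n \<Longrightarrow> g n \<le> d * f (d * n)"
    using assms(2) unfolding lin_le_def by blast
  show ?thesis unfolding lin_equiv_def
    using a b by (intro exI[of _ "max a b"] exI[of _ c] exI[of _ d] conjI) auto
qed

text \<open>\<open>Sup\<close> on the naturals is known to bound a set only when the set is bounded;
  any \<open>b\<close>, however crude, ensures this.\<close>

lemma asymmetry_upper:
  assumes "\<And>m f. 0 < m \<Longrightarrow> bij_betw f (words m) (words m) \<Longrightarrow> C m f \<le> s \<Longrightarrow> C m (inv_into (words m) f) \<le> b"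
    and "0 < m" "bij_betw f (words m) (words m)" "C m f \<le> s"
  shows "C m (inv_into (words m) f) \<le> asymmetry C s"
  unfolding asymmetry_def
proof (rule cSup_upper)
  show "bdd_above {C m (inv_into (words m) f) |m f. 0 < m \<and> bij_betw f (words m) (words m) \<and> C m f \<le> s}"
    using assms(1) by (intro bdd_aboveI[of _ b]) blast
qed (use assms(2-) in blast)

lemma asymmetry_least:
  assumes "\<And>m f. 0 < m \<Longrightarrow> bij_betw f (words m) (words m) \<Longrightarrow> C m f \<le> s \<Longrightarrow> C m (inv_into (words m) f) \<le> b"
  shows "asymmetry C s \<le> b"
  unfolding asymmetry_def using assms by (intro nat_Sup_le) blast

lemma lpG21_carrier: "lpG21 \<subseteq> carrier lepM21"
  unfolding lpG21_eq carrier_lepM21 using level_map_lift by blast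

lemma lpG21_inv_carrier: "g \<in> lpG21 \<Longrightarrow> inv\<^bsub>lepM21\<^esub> g \<in> lpG21"
  unfolding lpG21_eq using inv_lift bij_betw_inv_into by blast

text \<open>Boundedness is carried over together with the estimate, because the opposite comparison,
  with the two generating sets exchanged, starts from it.\<close>

lemma word_length_asymmetry_compare:
  assumes 1: "\<And>x. x \<in> carrier lepM21 \<Longrightarrow> word_length lepM21 S x \<le> c * word_length lepM21 S' x"
    and 2: "\<And>x. x \<in> carrier lepM21 \<Longrightarrow> word_length lepM21 S' x \<le> d * word_length lepM21 S x"
    and bdd: "\<And>n. bdd_above {word_length lepM21 S (inv\<^bsub>lepM21\<^esub> g) | g. g \<in> lpG21 \<and> word_length lepM21 S g \<le> n}"
    and "0 < c"
  shows "lin_le (word_length_asymmetry lepM21 lpG21 S') (word_length_asymmetry lepM21 lpG21 S)"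
    and "bdd_above {word_length lepM21 S' (inv\<^bsub>lepM21\<^esub> g) | g. g \<in> lpG21 \<and> word_length lepM21 S' g \<le> n}"
proof -
  let ?W = "word_length_asymmetry lepM21 lpG21 S"
  \<comment> \<open>One constant for both places: \<open>c\<close> rescales the argument and
    \<open>d\<close> the value.\<close>
  define e where "e = c + d"
  have bound: "word_length lepM21 S' (inv\<^bsub>lepM21\<^esub> g) \<le> e * ?W (e * n)"
    if g: "g \<in> lpG21" "word_length lepM21 S' g \<le> n" for g n
  proof -
    have "word_length lepM21 S g \<le> c * n"
      using 1[of g] g lpG21_carrier by (meson mult_le_mono2 order_trans subsetD)
    then have "word_length lepM21 S g \<le> e * n" by (simp add: e_def add_mult_distrib)
    then have "word_length lepM21 S (inv\<^bsub>lepM21\<^esub> g) \<le> ?W (e * n)"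
      unfolding word_length_asymmetry_def using g(1) by (intro cSup_upper bdd) blast
    then have "d * word_length lepM21 S (inv\<^bsub>lepM21\<^esub> g) \<le> e * ?W (e * n)"
      by (intro mult_le_mono) (simp_all add: e_def)
    then show ?thesis using 2[of "inv\<^bsub>lepM21\<^esub> g"] lpG21_inv_carrier[OF g(1)] lpG21_carrier by fastforce
  qed
  show "bdd_above {word_length lepM21 S' (inv\<^bsub>lepM21\<^esub> g) | g. g \<in> lpG21 \<and> word_length lepM21 S' g \<le> n}"
    using bound by (intro bdd_aboveI[of _ "e * ?W (e * n)"]) blast
  have "word_length_asymmetry lepM21 lpG21 S' n \<le> e * ?W (e * n)" for n
    unfolding word_length_asymmetry_def[of _ _ S'] using bound by (intro nat_Sup_le) blast
  then show "lin_le (word_length_asymmetry lepM21 lpG21 S') ?W"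
    using assms(4) by (intro lin_leI[of 1 e]) (simp_all add: e_def)
qed

section \<open>Minimal circuits and programs\<close>

lemma circuit_complexity_le:
  "computes B m n c f \<Longrightarrow> circuit_complexity B m n f \<le> length (nodes c) + m + n"
  unfolding circuit_complexity_def by (rule Least_le) blast

lemma circuit_complexity_attained:
  assumes "universal B" "0 < m" "0 < n" "f ` words m \<subseteq> words n"
  obtains c where "computes B m n c f" "length (nodes c) + m + n = circuit_complexity B m n f"
proof -
  obtain c where "computes B m n c f" using assms unfolding universal_def by blast
  then have "\<exists>s c. computes B m n c f \<and> length (nodes c) + m + n = s" by blast
  then have "\<exists>c. computes B m n c f \<and> length (nodes c) + m + n = circuit_complexity B m n f"
    unfolding circuit_complexity_def by (rule LeastI_ex)
  then show ?thesis using that by blast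
qed

lemma circuit_complexity_ge:
  assumes "universal B" "0 < m" "0 < n" "f ` words m \<subseteq> words n"
  shows "m + n \<le> circuit_complexity B m n f"
proof (rule circuit_complexity_attained[OF assms])
  fix c assume "length (nodes c) + m + n = circuit_complexity B m n f"
  then show ?thesis by simp
qed

lemma serial_complexity_le:
  "serial_computes B m ss f \<Longrightarrow> serial_complexity B m f \<le> length ss"
  unfolding serial_complexity_def by (rule Least_le) blast

lemma serial_computesI:
  "wf_steps B ss \<Longrightarrow> (\<And>x. length x = m \<Longrightarrow> run_steps ss x = Some (f x)) \<Longrightarrow> serial_computes B m ss f"
  unfolding serial_computes_def by (auto intro!: exI[of _ m])

lemma serial_complexity_attained:
  assumes "finite B" "universal B" "0 < m" "f ` words m \<subseteq> words m"
  obtains ss where "serial_computes B m ss f" "length ss = serial_complexity B m f"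
proof -
  have B: "\<forall>g\<in>B. valid_gate g" using assms(2) by (simp add: universal_def)
  obtain d where d: "\<forall>g\<in>B. gate_ins g \<le> d" "2 \<le> d" using gate_ins_bounded[OF assms(1)] .
  obtain c where "computes B m m c f" using assms(2-) unfolding universal_def by blast
  then obtain ss where "wf_steps B ss" "\<forall>x\<in>words m. run_steps ss x = Some (f x)"
    using circuit_to_steps[OF B d] by blast
  then have "serial_computes B m ss f" by (intro serial_computesI) simp_all
  then have "\<exists>k ss. serial_computes B m ss f \<and> length ss = k" by blast
  then have "\<exists>ss. serial_computes B m ss f \<and> length ss = serial_complexity B m f"
    unfolding serial_complexity_def by (rule LeastI_ex)
  then show ?thesis using that by blast
qed

text \<open>The ports are part of the size, so \<open>m \<le> s\<close>, and only finitely many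
  functions have to be considered.\<close>

lemma computational_asymmetry_upper:
  assumes "universal B" "0 < m" "bij_betw f (words m) (words m)" "circuit_complexity B m m f \<le> s"
  shows "circuit_complexity B m m (inv_into (words m) f) \<le> computational_asymmetry B s"
proof -
  define F where "F = (\<Union>m\<le>s. circuit_complexity B m m ` (words m \<rightarrow>\<^sub>E words m))"
  have "finite F" unfolding F_def using finite_words by (intro finite_UN_I finite_imageI finite_PiE) auto
  have "circuit_complexity B m m (inv_into (words m) f) \<le> Max F"
    if f: "0 < m" "bij_betw f (words m) (words m)" "circuit_complexity B m m f \<le> s" for m f
  proof -
    let ?f' = "inv_into (words m) f"
    have "f ` words m \<subseteq> words m" using f(2) by (simp add: bij_betw_def)
    from circuit_complexity_ge[OF assms(1) f(1,1) this] have "m \<le> s" using f(3) by linarith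
    \<comment> \<open>\<open>F\<close> ranges over extensional functions in order to be finite; the
      complexity sees only the values on \<open>words m\<close>.\<close>
    have "computes B m m c (restrict ?f' (words m)) = computes B m m c ?f'" for c
      by (simp add: computes_def)
    then have "circuit_complexity B m m ?f' = circuit_complexity B m m (restrict ?f' (words m))"
      unfolding circuit_complexity_def by simp
    moreover have "restrict ?f' (words m) \<in> words m \<rightarrow>\<^sub>E words m"
      using bij_betw_apply[OF bij_betw_inv_into[OF f(2)]] by (simp add: PiE_def Pi_def)
    ultimately have "circuit_complexity B m m ?f' \<in> F" using \<open>m \<le> s\<close> unfolding F_def by blast
    then show ?thesis using \<open>finite F\<close> by simp
  qed
  from asymmetry_upper[where C = "\<lambda>m. circuit_complexity B m m", OF this assms(2-4)]
  show ?thesis unfolding computational_asymmetry_def by simp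
qed

text \<open>The identity needs no nodes but has \<open>2 n\<close> ports. The bound pays for the
  swaps around the inverse circuit in \<open>serial_complexity_inverse\<close>.\<close>

lemma computational_asymmetry_ge:
  assumes "universal B" "0 < n"
  shows "2 * n \<le> computational_asymmetry B (2 * n)"
proof -
  define f where "f = (\<lambda>x :: word. x)"
  have bij: "bij_betw f (words n) (words n)" by (simp add: f_def bij_betw_def)
  obtain c where "computes B n n c f" "nodes c = []" using computes_id unfolding f_def by blast
  then have "circuit_complexity B n n f \<le> 2 * n" using circuit_complexity_le by fastforce
  from computational_asymmetry_upper[OF assms bij this]
  have *: "circuit_complexity B n n (inv_into (words n) f) \<le> computational_asymmetry B (2 * n)" .
  have "inv_into (words n) f ` words n \<subseteq> words n"
    using bij_betw_inv_into[OF bij] by (simp add: bij_betw_def)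
  from circuit_complexity_ge[OF assms(1,2,2) this] show ?thesis using * by simp
qed

section \<open>Bounding serial by computational asymmetry\<close>

lemma bij_words_length: "bij_betw f (words m) (words m) \<Longrightarrow> length x = m \<Longrightarrow> length (f x) = m"
  using bij_betw_apply[of f "words m" "words m" x] by simp

text \<open>The witness is \<open>\<sigma>\<^sup>-\<^sup>1 h\<^sup>-\<^sup>1 \<sigma>\<close>, where \<open>\<sigma>\<close> moves the touched wires to the front and
  \<open>h\<close> is the permutation induced on them.\<close>

lemma serial_complexity_inverse:
  assumes B: "finite B" "universal B" and d: "\<forall>g\<in>B. gate_ins g \<le> d" "2 \<le> d"
    and f: "0 < m" "bij_betw f (words m) (words m)" "serial_complexity B m f \<le> n" and "0 < n"
  defines "c \<equiv> 2 * d + 3"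
  shows "serial_complexity B m (inv_into (words m) f) \<le> c * computational_asymmetry B (c * n)"
proof -
  have v: "\<forall>g\<in>B. valid_gate g" using B by (simp add: universal_def)
  define f' where "f' = inv_into (words m) f"
  have ff': "f (f' x) = x" "length (f' x) = m" "length (f x) = m" if "length x = m" for x
    using f(2) bij_words_length[OF f(2)] bij_words_length[OF bij_betw_inv_into[OF f(2)]] that
    by (auto simp: f'_def bij_betw_def f_inv_into_f)
  have "f ` words m \<subseteq> words m" using f(2) by (simp add: bij_betw_def)
  from serial_complexity_attained[OF B f(1) this]
  obtain ss where "serial_computes B m ss f" and lss: "length ss = serial_complexity B m f" .
  then obtain M where ss: "wf_steps B ss" and M: "m \<le> M"
    and run: "\<And>x. length x = M \<Longrightarrow> run_steps ss x = Some (f (take m x) @ drop m x)"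
    unfolding serial_computes_def by auto
  define F where "F x = f (take m x) @ drop m x" for x
  have lF: "length (F x) = M" if "length x = M" for x using that ff'(3)[of "take m x"] M by (simp add: F_def)
  obtain I0 where I0: "I0 \<subseteq> {..<M}" "card I0 \<le> d * length ss"
    and same: "\<And>x p. length x = M \<Longrightarrow> p < M \<Longrightarrow> p \<notin> I0 \<Longrightarrow> F x ! p = x ! p"
    and cmp: "\<And>I. I0 \<subseteq> I \<Longrightarrow> I \<subseteq> {..<M} \<Longrightarrow> \<exists>ss'. wf_steps B ss' \<and> length ss' = length ss \<and>
      (\<forall>x. length x = M \<longrightarrow> run_steps ss' (nths x I) = Some (nths (F x) I))"
    using compress[OF v d ss run[folded F_def] lF] by metis
  \<comment> \<open>Wire 0 makes the set nonempty, since \<alpha> ranges over permutations of at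
    least one wire.\<close>
  define I where "I = insert 0 I0"
  define k where "k = card I"
  have I: "I0 \<subseteq> I" "I \<subseteq> {..<M}" using I0(1) M f(1) by (auto simp: I_def)
  have fI: "finite I0" using I0(1) finite_subset by blast
  have "k \<le> d * length ss + 1" using I0(2) fI by (simp add: k_def I_def card_insert_if)
  also have "\<dots> \<le> d * n + n"
    using lss f(3) \<open>0 < n\<close> by (intro add_mono mult_le_mono) auto
  finally have kn: "k \<le> (d + 1) * n" by simp
  have k0: "0 < k" using fI by (simp add: k_def I_def card_gt_0_iff)
  have ln: "length (nths x I) = k" if "length x = M" for x :: word
  proof -
    have "{i. i < M \<and> i \<in> I} = I" using I(2) by auto
    then show ?thesis by (simp add: length_nths that k_def)
  qed
  obtain ss' where ss': "wf_steps B ss'" "length ss' = length ss"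
    and run': "\<And>x. length x = M \<Longrightarrow> run_steps ss' (nths x I) = Some (nths (F x) I)"
    using cmp[OF I] by blast
  define h where "h u = the (run_steps ss' u)" for u
  have h: "h (nths x I) = nths (F x) I" if "length x = M" for x using run'[OF that] by (simp add: h_def)
  have hu: "run_steps ss' u = Some (h u) \<and> length (h u) = k" if u: "length u = k" for u
  proof -
    have "length u = card I" using u by (simp add: k_def)
    from nths_surj[OF I(2) this]
    obtain x where "length x = M" "nths x I = u" "\<And>p. p < M \<Longrightarrow> p \<notin> I \<Longrightarrow> \<not> x ! p" by blast
    then show ?thesis using run'[of x] h[of x] ln[OF lF] by auto
  qed
  \<comment> \<open>Both words are completed by \<open>False\<close> outside \<open>I\<close>.
    \<open>F\<close> fixes those wires, so equal images on \<open>I\<close> are equal images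
    throughout, and \<open>F\<close> inherits injectivity from \<open>f\<close>.\<close>
  have inj: "inj_on h (words k)"
  proof (rule inj_onI)
    fix u u' assume "u \<in> words k" "u' \<in> words k" and eq: "h u = h u'"
    then have "length u = card I" "length u' = card I" by (simp_all add: k_def)
    obtain x where x: "length x = M" "nths x I = u" "\<And>p. p < M \<Longrightarrow> p \<notin> I \<Longrightarrow> \<not> x ! p"
      using nths_surj[OF I(2) \<open>length u = card I\<close>] by blast
    obtain x' where x': "length x' = M" "nths x' I = u'" "\<And>p. p < M \<Longrightarrow> p \<notin> I \<Longrightarrow> \<not> x' ! p"
      using nths_surj[OF I(2) \<open>length u' = card I\<close>] by blast
    have eqI: "nths (F x) I = nths (F x') I" using eq h x(1,2) x'(1,2) by metis
    have "F x = F x'"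
    proof (rule nth_equalityI)
      show "length (F x) = length (F x')" using lF x(1) x'(1) by simp
      fix p assume "p < length (F x)"
      then have p: "p < M" using lF x(1) by simp
      show "F x ! p = F x' ! p"
      proof (cases "p \<in> I")
        case True
        then have "p \<in> set (filter (\<lambda>i. i \<in> I) [0..<M])" using p by simp
        then show ?thesis using eqI lF x(1) x'(1) unfolding nths_conv_map by simp
      next
        case False
        then show ?thesis using same[OF x(1) p] same[OF x'(1) p] x(3)[OF p] x'(3)[OF p] I(1) by blast
      qed
    qed
    then have "f (take m x) = f (take m x')" "drop m x = drop m x'"
      using ff'(3)[of "take m x"] ff'(3)[of "take m x'"] x(1) x'(1) M by (auto simp: F_def)
    moreover have "take m x = take m x'"
      by (rule inj_onD[OF bij_betw_imp_inj_on[OF f(2)] calculation(1)]) (use x(1) x'(1) M in auto)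
    ultimately have "x = x'" by (metis append_take_drop_id)
    then show "u = u'" using x(2) x'(2) by simp
  qed
  moreover have "h ` words k \<subseteq> words k" using hu by auto
  ultimately have bij: "bij_betw h (words k) (words k)"
    using finite_words endo_inj_surj by (metis bij_betw_def)
  have "\<And>u. length u = k \<Longrightarrow> run_steps ss' u = Some (h u)" using hu by simp
  from steps_to_circuit[OF v ss'(1) this]
  obtain n' cc where cc: "computes B k n' cc h" "length (nodes cc) \<le> length ss'" by blast
  have "n' = k" using computes_length[OF cc(1), of "replicate k True"] hu[of "replicate k True"] by simp
  then have "circuit_complexity B k k h \<le> length ss + k + k"
    using circuit_complexity_le[OF cc(1)] cc(2) ss'(2) by simp
  also have "\<dots> \<le> n + (d + 1) * n + (d + 1) * n" using lss f(3) kn by linarith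
  \<comment> \<open>Origin of \<open>c\<close>: at most \<open>n\<close> nodes, and at most
    \<open>(d + 1) * n\<close> ports on either side.\<close>
  also have "\<dots> = c * n" by (simp add: c_def algebra_simps)
  finally have Ch: "circuit_complexity B k k h \<le> c * n" .
  define A where "A = computational_asymmetry B (c * n)"
  define h' where "h' = inv_into (words k) h"
  have Ch': "circuit_complexity B k k h' \<le> A"
    unfolding A_def h'_def by (rule computational_asymmetry_upper[OF B(2) k0 bij Ch])
  have "h' ` words k \<subseteq> words k" using bij_betw_inv_into[OF bij] by (simp add: bij_betw_def h'_def)
  from circuit_complexity_attained[OF B(2) k0 k0 this]
  obtain c' where c': "computes B k k c' h'" "length (nodes c') + k + k = circuit_complexity B k k h'" .
  obtain ss2 where ss2: "wf_steps B ss2" "length ss2 \<le> length (nodes c') * Suc d + k"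
    "\<And>u. length u = k \<Longrightarrow> run_steps ss2 u = Some (h' u)"
    using circuit_to_steps[OF v d c'(1)] by auto
  \<comment> \<open>The ports contained in the circuit size pay for the final rearrangement of the
    \<open>k\<close> outputs.\<close>
  have "length (nodes c') * Suc d + k \<le> (length (nodes c') + k + k) * Suc d" by (simp add: algebra_simps)
  also have "\<dots> \<le> A * Suc d" using Ch' c'(2) by (intro mult_le_mono1) simp
  finally have lss2: "length ss2 \<le> A * Suc d" using ss2(2) by simp
  define L where "L = filter (\<lambda>i. i \<in> I) [0..<M]"
  have L: "distinct L" "set L \<subseteq> set [0..<M]" by (auto simp: L_def)
  have "set L = I" using I(2) by (auto simp: L_def)
  then have lL: "length L = k" using distinct_card[OF L(1)] by (simp add: k_def)
  obtain \<sigma> q where \<sigma>: "wf_steps B \<sigma>" "length \<sigma> \<le> length L" "distinct q" "set q = set [0..<M]"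
    "take (length L) q = L" "\<And>h. run_steps \<sigma> (map h [0..<M]) = Some (map h q)"
    "\<And>h. run_steps (rev \<sigma>) (map h q) = Some (map h [0..<M])"
    using bring_to_front[OF distinct_upt L, of B] by blast
  define r where "r = drop (length L) q"
  have q: "q = L @ r" using \<sigma>(5) by (metis append_take_drop_id r_def)
  have r: "p < M \<and> p \<notin> I" if "p \<in> set r" for p
    using that \<sigma>(3,4) \<open>set L = I\<close> unfolding q by auto
  have m: "map ((!) x) [0..<M] = x" if "length x = M" for x :: word using that map_nth by blast
  have mL: "map ((!) x) q = nths x I @ map ((!) x) r" if "length x = M" for x :: word
    unfolding q by (simp add: nths_conv_map that L_def)
  define prog where "prog = \<sigma> @ ss2 @ rev \<sigma>"
  have "run_steps prog y = Some (f' (take m y) @ drop m y)" if y: "length y = M" for y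
  proof -
    define x where "x = f' (take m y) @ drop m y"
    have x: "length x = M" "F x = y" using ff'[of "take m y"] y M by (auto simp: x_def F_def)
    have "h (nths x I) = nths y I" using h[OF x(1)] x(2) by simp
    then have h'y: "h' (nths y I) = nths x I"
      using inj ln[OF x(1)] unfolding h'_def by (metis in_words inv_into_f_f)
    \<comment> \<open>\<open>F\<close> fixes the wires outside \<open>I\<close>, so \<open>y\<close>
      and its preimage \<open>x\<close> agree there.\<close>
    have ry: "map ((!) y) r = map ((!) x) r"
      using same[OF x(1)] x(2) r I(1) by (auto intro!: map_cong)
    have 1: "run_steps \<sigma> y = Some (nths y I @ map ((!) y) r)"
      using \<sigma>(6)[of "(!) y"] m[OF y] mL[OF y] by simp
    have 2: "run_steps ss2 (nths y I @ map ((!) y) r) = Some (nths x I @ map ((!) x) r)"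
      using run_steps_extend[OF ss2(1) ss2(3)[OF ln[OF y]]] by (simp add: h'y ry)
    have 3: "run_steps (rev \<sigma>) (nths x I @ map ((!) x) r) = Some x"
      using \<sigma>(7)[of "(!) x"] m[OF x(1)] mL[OF x(1)] by simp
    show ?thesis using 1 2 3 by (simp add: prog_def run_steps_append x_def)
  qed
  moreover have "wf_steps B prog" using \<sigma>(1) ss2(1) by (auto simp: prog_def)
  ultimately have "serial_computes B m prog f'"
    unfolding serial_computes_def using M by auto
  then have "serial_complexity B m f' \<le> length prog" by (rule serial_complexity_le)
  also have "\<dots> \<le> A * Suc d + 2 * k" using lss2 \<sigma>(2) lL by (simp add: prog_def)
  \<comment> \<open>The \<open>2 * k\<close> swaps are paid for by
    \<open>2 n \<le> \<alpha>(2 n) \<le> A\<close>.\<close>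
  also have "\<dots> \<le> A * Suc d + Suc d * A"
  proof -
    have "2 * n \<le> computational_asymmetry B (2 * n)" using computational_asymmetry_ge B(2) \<open>0 < n\<close> by blast
    also have "\<dots> \<le> A"
      unfolding A_def computational_asymmetry_def
    proof (rule asymmetry_least)
      fix m f assume f: "0 < m" "bij_betw f (words m) (words m)" "circuit_complexity B m m f \<le> 2 * n"
      have "2 * n \<le> c * n" by (simp add: c_def)
      then have "circuit_complexity B m m f \<le> c * n" using f(3) by linarith
      from computational_asymmetry_upper[OF B(2) f(1,2) this]
      show "circuit_complexity B m m (inv_into (words m) f) \<le> asymmetry (\<lambda>m. circuit_complexity B m m) (c * n)"
        unfolding computational_asymmetry_def .
    qed
    finally have "Suc d * (2 * n) \<le> Suc d * A" by (rule mult_le_mono2)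
    then show ?thesis using kn by (simp add: algebra_simps)
  qed
  also have "\<dots> \<le> c * A" by (simp add: c_def algebra_simps)
  finally show ?thesis unfolding f'_def A_def .
qed

text \<open>The estimate for inverses bounds the set under \<open>Sup\<close>. Counting could not,
  as infinitely many permutations share one small serial complexity.\<close>

lemma serial_asymmetry_upper:
  assumes B: "finite B" "universal B"
    and f: "0 < m" "bij_betw f (words m) (words m)" "serial_complexity B m f \<le> n"
  shows "serial_complexity B m (inv_into (words m) f) \<le> serial_asymmetry B n"
proof -
  obtain d where d: "\<forall>g\<in>B. gate_ins g \<le> d" "2 \<le> d" using gate_ins_bounded[OF B(1)] .
  \<comment> \<open>\<open>Suc n\<close>, because the estimate for inverses requires a positive
    length.\<close>
  define b where "b = (2 * d + 3) * computational_asymmetry B ((2 * d + 3) * Suc n)"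
  have *: "serial_complexity B m (inv_into (words m) f) \<le> b"
    if "0 < m" "bij_betw f (words m) (words m)" "serial_complexity B m f \<le> n" for m f
    unfolding b_def by (rule serial_complexity_inverse[OF B d]) (use that in auto)
  from asymmetry_upper[where C = "serial_complexity B", OF * f]
  show ?thesis unfolding serial_asymmetry_def by simp
qed

lemma serial_asymmetry_lin_le:
  assumes B: "finite B" "universal B"
  shows "lin_le (serial_asymmetry B) (computational_asymmetry B)"
proof -
  obtain d where d: "\<forall>g\<in>B. gate_ins g \<le> d" "2 \<le> d" using gate_ins_bounded[OF B(1)] .
  define c where "c = 2 * d + 3"
  have "serial_asymmetry B n \<le> c * computational_asymmetry B (c * n)" if n: "1 \<le> n" for n
    unfolding serial_asymmetry_def
  proof (rule asymmetry_least)
    fix m f assume "0 < m" "bij_betw f (words m) (words m)" "serial_complexity B m f \<le> n"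
    from serial_complexity_inverse[OF B d this] n
    show "serial_complexity B m (inv_into (words m) f) \<le> c * computational_asymmetry B (c * n)"
      by (simp add: c_def)
  qed
  then show ?thesis by (intro lin_leI[of 1 c]) (simp_all add: c_def)
qed

section \<open>Bounding computational by serial asymmetry\<close>

text \<open>Universality provides no circuits without inputs, so a constant wire is created in front
  of an existing one; hence \<open>x\<close> is nonempty.\<close>

lemma run_add_zeros:
  assumes "wf_steps B U" "\<And>b. run_steps U [b] = Some [False, b]" "x \<noteq> []"
  shows "run_steps (concat (replicate r U)) x = Some (replicate r False @ x)"
  using assms(3)
proof (induction r arbitrary: x)
  case (Suc r)
  then obtain b z where x: "x = [b] @ z" by (cases x) auto
  have "run_steps U x = Some (False # x)"
    unfolding x using run_steps_extend[OF assms(1,2)] by simp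
  then show ?case using Suc.IH[of "False # x"]
    by (simp add: run_steps_append replicate_app_Cons_same)
qed simp

text \<open>Universality provides no circuits without outputs either, so a wire is deleted in the
  presence of the next one.\<close>

lemma run_delete_wires:
  assumes "wf_steps B V" "\<And>a b. run_steps V [a, b] = Some [b]" "x \<noteq> []"
  shows "length w = r \<Longrightarrow> run_steps (concat (replicate r V)) (w @ x) = Some x"
proof (induction r arbitrary: w)
  case (Suc r)
  then obtain a w' where w: "w = a # w'" "length w' = r" by (cases w) auto
  obtain b z where wx: "w' @ x = b # z" using assms(3) by (cases "w' @ x") auto
  have "run_steps V ([a, b] @ z) = Some ([b] @ z)" using run_steps_extend[OF assms(1,2)] .
  then have "run_steps V (w @ x) = Some (w' @ x)" using w(1) wx by simp
  then show ?case using Suc.IH[OF w(2)] by (simp add: run_steps_append)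
qed simp

text \<open>Reversal is its own inverse and takes at most \<open>n\<close> swaps, so the serial
  complexity of its inverse enters the supremum at \<open>n\<close>. A step of a program for it
  touches at most \<open>d\<close> wires, and every wire that can change must be touched.\<close>

lemma linear_lower_bound:
  assumes B: "finite B" "universal B" and d: "\<forall>g\<in>B. gate_ins g \<le> d" "2 \<le> d" and "0 < n"
  shows "n \<le> d * serial_asymmetry B n + 1"
proof -
  have v: "\<forall>g\<in>B. valid_gate g" using B by (simp add: universal_def)
  define g where "g = inv_into (words n) rev"
  have bij: "bij_betw rev (words n) (words n)" by (intro bij_betwI[of _ _ _ rev]) auto
  have g: "g x = rev x" if "length x = n" for x
    unfolding g_def using inv_into_f_f[OF bij_betw_imp_inj_on[OF bij], of "rev x"] that by simp
  have "distinct (rev [0..<n])" "set (rev [0..<n]) = {..<n}" by (auto simp: lessThan_atLeast0)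
  from permute_steps[OF this, of B]
  obtain ss where ss: "wf_steps B ss" "length ss \<le> n"
    "\<And>x. length x = n \<Longrightarrow> run_steps ss x = Some (map ((!) x) (rev [0..<n]))"
    "\<And>x. length x = n \<Longrightarrow> run_steps (rev ss) (map ((!) x) (rev [0..<n])) = Some x" by blast
  have "run_steps ss x = Some (rev x)" if "length x = n" for x
  proof -
    have "map ((!) x) [0..<n] = x" using that map_nth by blast
    then show ?thesis using ss(3)[OF that] by (simp flip: rev_map)
  qed
  then have "serial_computes B n ss rev" by (intro serial_computesI ss(1))
  then have "serial_complexity B n rev \<le> n" using serial_complexity_le ss(2) order_trans by blast
  from serial_asymmetry_upper[OF B \<open>0 < n\<close> bij this]
  have le: "serial_complexity B n g \<le> serial_asymmetry B n" unfolding g_def .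
  have "g ` words n \<subseteq> words n" using g by auto
  from serial_complexity_attained[OF B \<open>0 < n\<close> this]
  obtain ts where "serial_computes B n ts g" and lts: "length ts = serial_complexity B n g" .
  then obtain M where ts: "wf_steps B ts" and M: "n \<le> M"
    and run: "\<And>x. length x = M \<Longrightarrow> run_steps ts x = Some (g (take n x) @ drop n x)"
    unfolding serial_computes_def by auto
  have len: "length (g (take n x) @ drop n x) = M" if "length x = M" for x using that g M by simp
  obtain I0 where I0: "I0 \<subseteq> {..<M}" "card I0 \<le> d * length ts"
    and same: "\<And>x p. length x = M \<Longrightarrow> p < M \<Longrightarrow> p \<notin> I0 \<Longrightarrow> (g (take n x) @ drop n x) ! p = x ! p"
    using compress[OF v d ts run len] by metis
  \<comment> \<open>\<open>(n - 1) div 2\<close> is the only position that reversal can fix, the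
    middle one for odd \<open>n\<close>; for even \<open>n\<close> every wire moves.\<close>
  have "{..<n} \<subseteq> insert ((n - 1) div 2) I0"
  proof
    fix p assume "p \<in> {..<n}"
    then have p: "p < n" by simp
    show "p \<in> insert ((n - 1) div 2) I0"
    proof (cases "p = n - 1 - p")
      case True
      then have "p = (n - 1) div 2" using p by linarith
      then show ?thesis by simp
    next
      case False
      \<comment> \<open>A single true bit at \<open>p\<close> is moved away, so \<open>p\<close> is
        touched.\<close>
      define x where "x = (replicate M False)[p := True]"
      have x: "length x = M" "x ! p" "\<not> x ! (n - 1 - p)" using p M False by (auto simp: x_def)
      have "(g (take n x) @ drop n x) ! p = x ! (n - 1 - p)"
        using g[of "take n x"] x(1) p M by (simp add: nth_append rev_nth)
      then show ?thesis using same[OF x(1), of p] x p M by auto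
    qed
  qed
  moreover have fI: "finite I0" using I0(1) finite_subset by blast
  ultimately have "card {..<n} \<le> card (insert ((n - 1) div 2) I0)" by (intro card_mono) auto
  also have "\<dots> \<le> card I0 + 1" using fI by (simp add: card_insert_if)
  finally have "n \<le> d * length ts + 1" using I0(2) by simp
  also have "\<dots> \<le> d * serial_asymmetry B n + 1" using le lts by simp
  finally show ?thesis .
qed

lemma serial_asymmetry_mono:
  assumes "finite B" "universal B" "n \<le> n'"
  shows "serial_asymmetry B n \<le> serial_asymmetry B n'"
proof -
  have "asymmetry (serial_complexity B) n \<le> serial_asymmetry B n'"
    using serial_asymmetry_upper[OF assms(1,2)] assms(3) by (intro asymmetry_least) simp
  then show ?thesis by (simp add: serial_asymmetry_def)
qed

lemma word_program:
  assumes B: "finite B" "universal B" and "0 < m" "0 < n" "\<And>x. length x = m \<Longrightarrow> length (f x) = n"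
  obtains ss where "wf_steps B ss" "\<And>x. length x = m \<Longrightarrow> run_steps ss x = Some (f x)"
proof -
  have v: "\<forall>g\<in>B. valid_gate g" using B by (simp add: universal_def)
  obtain d where d: "\<forall>g\<in>B. gate_ins g \<le> d" "2 \<le> d" using gate_ins_bounded[OF B(1)] .
  have "f ` words m \<subseteq> words n" using assms(5) by auto
  then obtain c where "computes B m n c f" using B(2) assms(3,4) unfolding universal_def by blast
  from circuit_to_steps[OF v d this] show ?thesis using that by auto
qed

text \<open>A circuit for \<open>f\<close> has exactly \<open>m\<close> inputs and outputs, whereas
  the program may borrow wires. It returns them unchanged whatever they carry, so constants can be
  supplied and deleted afterwards; compression keeps their number linear in the program
  length.\<close>

lemma circuit_complexity_le_serial:
  assumes B: "finite B" "universal B"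
  obtains e where "\<And>m f. 0 < m \<Longrightarrow> f ` words m \<subseteq> words m \<Longrightarrow>
    circuit_complexity B m m f \<le> e * serial_complexity B m f + 4 * m"
proof -
  have v: "\<forall>g\<in>B. valid_gate g" using B by (simp add: universal_def)
  obtain d where d: "\<forall>g\<in>B. gate_ins g \<le> d" "2 \<le> d" using gate_ins_bounded[OF B(1)] .
  obtain U where U: "wf_steps B U" "\<And>x. length x = 1 \<Longrightarrow> run_steps U x = Some (False # x)"
    using word_program[OF B, of 1 2 "(#) False"] by auto
  obtain V where V: "wf_steps B V" "\<And>x. length x = 2 \<Longrightarrow> run_steps V x = Some (tl x)"
    using word_program[OF B, of 2 1 tl] by auto
  \<comment> \<open>Each of the at most \<open>d * length ss\<close> borrowed wires costs one run of
    \<open>U\<close>, one of \<open>V\<close> and a swap before and after; the 1 stands for the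
    program.\<close>
  define e where "e = d * (length U + length V + 2) + 1"
  show ?thesis
  proof (rule that[of e])
    fix m f assume m: "0 < m" and f: "f ` words m \<subseteq> words m"
    have lf: "length (f x) = m" if "length x = m" for x using f that by (metis image_subset_iff in_words)
    from serial_complexity_attained[OF B m f]
    obtain ss where "serial_computes B m ss f" and lss: "length ss = serial_complexity B m f" .
    then obtain M where ss: "wf_steps B ss" and M: "m \<le> M"
      and run: "\<And>x. length x = M \<Longrightarrow> run_steps ss x = Some (f (take m x) @ drop m x)"
      unfolding serial_computes_def by auto
    have len: "length (f (take m x) @ drop m x) = M" if "length x = M" for x using that lf M by simp
    obtain I0 where I0: "I0 \<subseteq> {..<M}" "card I0 \<le> d * length ss"
      and cmp: "\<And>I. I0 \<subseteq> I \<Longrightarrow> I \<subseteq> {..<M} \<Longrightarrow> \<exists>ss'. wf_steps B ss' \<and> length ss' = length ss \<and>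
        (\<forall>x. length x = M \<longrightarrow> run_steps ss' (nths x I) = Some (nths (f (take m x) @ drop m x) I))"
      using compress[OF v d ss run len] by metis
    \<comment> \<open>All inputs are kept, so that the selected wires are the \<open>m\<close>
      inputs followed by \<open>r\<close> borrowed ones.\<close>
    define I where "I = {..<m} \<union> I0"
    have I: "I0 \<subseteq> I" "I \<subseteq> {..<M}" "{..<m} \<subseteq> I" using I0(1) M by (auto simp: I_def)
    obtain ss' where ss': "wf_steps B ss'" "length ss' = length ss"
      and run': "\<And>x. length x = M \<Longrightarrow> run_steps ss' (nths x I) = Some (nths (f (take m x) @ drop m x) I)"
      using cmp[OF I(1,2)] by blast
    define r where "r = card (I0 - {..<m})"
    have fI: "finite I0" using I0(1) finite_subset by blast
    have "card I = card ({..<m} \<union> (I0 - {..<m}))" by (rule arg_cong[of _ _ card]) (auto simp: I_def)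
    also have "\<dots> = m + r" using fI by (subst card_Un_disjoint) (auto simp: r_def)
    finally have cI: "card I = m + r" .
    have "r \<le> card I0" unfolding r_def using fI by (intro card_mono) auto
    then have r: "r \<le> d * length ss" using I0(2) by simp
    have run2: "run_steps ss' (x @ w) = Some (f x @ w)" if x: "length x = m" and w: "length w = r" for x w
    proof -
      have "length (x @ w) = card I" using x w cI by simp
      from nths_surj[OF I(2) this]
      obtain y where y: "length y = M" "nths y I = x @ w" "\<And>p. p < M \<Longrightarrow> p \<notin> I \<Longrightarrow> \<not> y ! p" by blast
      have split: "nths (u @ drop m y) I = u @ nths (drop m y) {j. j + m \<in> I}" if "length u = m" for u
      proof -
        have "nths u I = u" using I(3) that by (intro nths_all) auto
        then show ?thesis using that by (simp add: nths_append)
      qed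
      have "length (take m y) = m" using y(1) M by simp
      from split[OF this] have "x @ w = take m y @ nths (drop m y) {j. j + m \<in> I}" using y(2) by simp
      then have "x = take m y" "w = nths (drop m y) {j. j + m \<in> I}"
        using x \<open>length (take m y) = m\<close> by (auto simp: append_eq_append_conv)
      then show ?thesis using run'[OF y(1)] split[OF lf[OF x]] y(2) by simp
    qed
    \<comment> \<open>New wires are created in front of the inputs, but the compressed program
      expects them behind.\<close>
    define t where "t = [r..<r + m] @ [0..<r]"
    have t: "distinct t" "set t = {..<r + m}" by (auto simp: t_def)
    obtain \<rho> where \<rho>: "wf_steps B \<rho>" "length \<rho> \<le> r + m"
      "\<And>x. length x = r + m \<Longrightarrow> run_steps \<rho> x = Some (map ((!) x) t)"
      "\<And>x. length x = r + m \<Longrightarrow> run_steps (rev \<rho>) (map ((!) x) t) = Some x"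
      using permute_steps[OF t, of B] by blast
    have rot: "map ((!) (w @ x)) t = x @ w" if "length w = r" "length x = m" for w x :: word
    proof -
      have "map ((!) (w @ x)) [r..<r + m] = x" "map ((!) (w @ x)) [0..<r] = w"
        using that by (auto intro!: nth_equalityI simp: nth_append)
      then show ?thesis by (simp add: t_def)
    qed
    define prog where
      "prog = concat (replicate r U) @ \<rho> @ ss' @ rev \<rho> @ concat (replicate r V)"
    have "run_steps prog x = Some (f x)" if x: "length x = m" for x
    proof -
      define w where "w = replicate r False"
      have w: "length w = r" by (simp add: w_def)
      have "x \<noteq> []" "f x \<noteq> []" using x m lf[OF x] by auto
      have 1: "run_steps (concat (replicate r U)) x = Some (w @ x)"
        unfolding w_def by (rule run_add_zeros[OF U(1) _ \<open>x \<noteq> []\<close>]) (use U(2) in simp)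
      have 2: "run_steps \<rho> (w @ x) = Some (x @ w)" using \<rho>(3)[of "w @ x"] rot[OF w x] x w by simp
      have 3: "run_steps (rev \<rho>) (f x @ w) = Some (w @ f x)"
        using \<rho>(4)[of "w @ f x"] rot[OF w lf[OF x]] lf[OF x] w by simp
      have 4: "run_steps (concat (replicate r V)) (w @ f x) = Some (f x)"
        by (rule run_delete_wires[OF V(1) _ \<open>f x \<noteq> []\<close> w]) (use V(2) in simp)
      show ?thesis using 1 2 3 4 run2[OF x w] by (simp add: prog_def run_steps_append)
    qed
    moreover have "wf_steps B prog" using U(1) V(1) \<rho>(1) ss'(1) by (auto simp: prog_def)
    ultimately obtain n' c where c: "computes B m n' c f" "length (nodes c) \<le> length prog"
      using steps_to_circuit[OF v] by blast
    have "n' = m" using computes_length[OF c(1), of "replicate m True"] lf[of "replicate m True"] by simp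
    \<comment> \<open>These \<open>2 * m\<close> are the ports; the two rearrangements contribute
      another \<open>2 * m\<close>.\<close>
    then have "circuit_complexity B m m f \<le> length prog + 2 * m"
      using circuit_complexity_le[OF c(1)] c(2) by simp
    also have "length prog \<le> r * length U + r * length V + 2 * (r + m) + length ss"
      using \<rho>(2) ss'(2) by (simp add: prog_def length_concat sum_list_replicate)
    also have "\<dots> = r * (length U + length V + 2) + length ss + 2 * m" by (simp add: algebra_simps)
    also have "\<dots> \<le> d * length ss * (length U + length V + 2) + length ss + 2 * m"
      using r by (intro add_mono mult_le_mono1) auto
    also have "\<dots> = e * length ss + 2 * m" by (simp add: e_def algebra_simps)
    finally show "circuit_complexity B m m f \<le> e * serial_complexity B m f + 4 * m" using lss by simp
  qed
qed

lemma computational_asymmetry_lin_le: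
  assumes B: "finite B" "universal B"
  shows "lin_le (computational_asymmetry B) (serial_asymmetry B)"
proof -
  have v: "\<forall>g\<in>B. valid_gate g" using B by (simp add: universal_def)
  obtain d where d: "\<forall>g\<in>B. gate_ins g \<le> d" "2 \<le> d" using gate_ins_bounded[OF B(1)] .
  obtain e where e: "\<And>m f. 0 < m \<Longrightarrow> f ` words m \<subseteq> words m \<Longrightarrow>
    circuit_complexity B m m f \<le> e * serial_complexity B m f + 4 * m"
    using circuit_complexity_le_serial[OF B] by blast
  \<comment> \<open>\<open>e\<close> is the factor from serial to circuit complexity,
    \<open>4 * d\<close> absorbs the term \<open>4 * m\<close>, and \<open>c\<close> is at least
    \<open>Suc d\<close>, the factor from circuits to programs.\<close>
  define c where "c = e + 4 * d + 1"
  have "computational_asymmetry B s \<le> c * serial_asymmetry B (c * s)" if s: "2 \<le> s" for s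
    unfolding computational_asymmetry_def
  proof (rule asymmetry_least)
    fix m f assume m: "0 < m" and f: "bij_betw f (words m) (words m)" "circuit_complexity B m m f \<le> s"
    define f' where "f' = inv_into (words m) f"
    have "f ` words m \<subseteq> words m" using f(1) by (simp add: bij_betw_def)
    from circuit_complexity_attained[OF B(2) m m this]
    obtain cc where cc: "computes B m m cc f" "length (nodes cc) + m + m = circuit_complexity B m m f" .
    have ms: "length (nodes cc) + m + m \<le> s" using cc(2) f(2) by simp
    obtain ss where ss: "wf_steps B ss" "length ss \<le> length (nodes cc) * Suc d + m"
      "\<forall>x\<in>words m. run_steps ss x = Some (f x)" using circuit_to_steps[OF v d cc(1)] by blast
    have "serial_complexity B m f \<le> length ss"
      using ss(3) by (intro serial_complexity_le serial_computesI[OF ss(1)]) simp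
    also have "\<dots> \<le> (length (nodes cc) + m + m) * Suc d" using ss(2) by (simp add: algebra_simps)
    also have "\<dots> \<le> s * Suc d" using ms by (rule mult_le_mono1)
    also have "\<dots> \<le> c * s" using d(2) by (simp add: c_def algebra_simps)
    finally have "serial_complexity B m f \<le> c * s" .
    from serial_asymmetry_upper[OF B m f(1) this]
    have sc: "serial_complexity B m f' \<le> serial_asymmetry B (c * s)" unfolding f'_def .
    have "s \<le> c * s" by (simp add: c_def)
    then have "serial_asymmetry B s \<le> serial_asymmetry B (c * s)" by (rule serial_asymmetry_mono[OF B])
    then have "d * serial_asymmetry B s \<le> d * serial_asymmetry B (c * s)" by simp
    \<comment> \<open>Here \<open>2 \<le> s\<close> turns the summand 1 of the lower bound into a
      factor 2.\<close>
    then have ls: "s \<le> 2 * (d * serial_asymmetry B (c * s))"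
      using linear_lower_bound[OF B d, of s] s by linarith
    have "f' ` words m \<subseteq> words m" using bij_betw_inv_into[OF f(1)] by (simp add: f'_def bij_betw_def)
    from e[OF m this] have "circuit_complexity B m m f' \<le> e * serial_complexity B m f' + 4 * m" .
    also have "\<dots> \<le> e * serial_asymmetry B (c * s) + 2 * s" using sc ms by (intro add_mono mult_le_mono2) auto
    also have "\<dots> \<le> e * serial_asymmetry B (c * s) + 4 * (d * serial_asymmetry B (c * s))" using ls by simp
    also have "\<dots> \<le> c * serial_asymmetry B (c * s)" by (simp add: c_def algebra_simps)
    finally show "circuit_complexity B m m (inv_into (words m) f) \<le> c * serial_asymmetry B (c * s)"
      unfolding f'_def .
  qed
  then show ?thesis by (intro lin_leI[of 2 c]) (simp_all add: c_def)
qed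

theorem proposition3p1:
  fixes B :: "gate set"
  assumes "finite B" and "universal B"
  shows
    "(\<forall>\<Gamma>. finite \<Gamma> \<and> generates lepM21 (\<Gamma> \<union> bit_transpositions) \<longrightarrow>
        computational_asymmetry B \<simeq>\<^sub>l\<^sub>i\<^sub>n
        word_length_asymmetry lepM21 lpG21 (\<Gamma> \<union> bit_transpositions)) \<and>
     (\<exists>\<Gamma>. \<Gamma> = gate_elements B \<and> finite \<Gamma> \<and>
        generates lepM21 (\<Gamma> \<union> bit_transpositions) \<and>
        serial_asymmetry B = word_length_asymmetry lepM21 lpG21 (\<Gamma> \<union> bit_transpositions))"
proof (intro conjI allI impI exI[of _ "gate_elements B"])
  have v: "\<forall>g\<in>B. valid_gate g" using assms by (simp add: universal_def)
  let ?S = "gate_elements B \<union> bit_transpositions"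
  show fin: "finite (gate_elements B)" using assms(1) by (simp add: gate_elements_def)
  show gen: "generates lepM21 ?S"
    using circuit_generators_generate[OF assms] by (simp add: circuit_generators_def)
  show eq: "serial_asymmetry B = word_length_asymmetry lepM21 lpG21 ?S"
    using serial_asymmetry_eq[OF v] by (simp add: circuit_generators_def)
  \<comment> \<open>Over the gates, word lengths are serial complexities, for which the bound on
    inverses is available.\<close>
  have bdd: "bdd_above {word_length lepM21 ?S (inv\<^bsub>lepM21\<^esub> g) | g. g \<in> lpG21 \<and> word_length lepM21 ?S g \<le> n}" for n
  proof (rule bdd_aboveI[of _ "serial_asymmetry B n"])
    fix k assume "k \<in> {word_length lepM21 ?S (inv\<^bsub>lepM21\<^esub> g) | g. g \<in> lpG21 \<and> word_length lepM21 ?S g \<le> n}"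
    then obtain g where g: "k = word_length lepM21 ?S (inv\<^bsub>lepM21\<^esub> g)" "g \<in> lpG21"
      "word_length lepM21 ?S g \<le> n" by blast
    then obtain m f where f: "g = max_ext (lift m f)" "0 < m" "bij_betw f (words m) (words m)"
      unfolding lpG21_eq by blast
    have wl: "word_length lepM21 ?S (max_ext (lift m f)) = serial_complexity B m f" for m f
      using word_length_lift[OF v] by (simp add: circuit_generators_def)
    show "k \<le> serial_asymmetry B n"
      using serial_asymmetry_upper[OF assms f(2,3)] g by (simp add: f(1) inv_lift[OF f(3)] wl)
  qed
  fix \<Gamma> assume \<Gamma>: "finite \<Gamma> \<and> generates lepM21 (\<Gamma> \<union> bit_transpositions)"
  obtain c where c: "0 < c" "\<And>x. x \<in> carrier lepM21 \<Longrightarrow>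
      word_length lepM21 ?S x \<le> c * word_length lepM21 (\<Gamma> \<union> bit_transpositions) x"
    using lepM21.word_length_compare[OF gen] \<Gamma> by blast
  obtain d where d: "0 < d" "\<And>x. x \<in> carrier lepM21 \<Longrightarrow>
      word_length lepM21 (\<Gamma> \<union> bit_transpositions) x \<le> d * word_length lepM21 ?S x"
    using lepM21.word_length_compare[OF _ gen fin] \<Gamma> by blast
  note compare = word_length_asymmetry_compare
  \<comment> \<open>Boundedness over \<open>\<Gamma>\<close> is inherited from the gates before the
    comparison is reversed.\<close>
  have bdd': "bdd_above {word_length lepM21 (\<Gamma> \<union> bit_transpositions) (inv\<^bsub>lepM21\<^esub> g) | g.
      g \<in> lpG21 \<and> word_length lepM21 (\<Gamma> \<union> bit_transpositions) g \<le> n}" for n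
    by (rule compare(2)[OF c(2) d(2) bdd c(1)])
  have "lin_le (word_length_asymmetry lepM21 lpG21 (\<Gamma> \<union> bit_transpositions)) (serial_asymmetry B)"
    unfolding eq by (rule compare(1)[OF c(2) d(2) bdd c(1)])
  moreover have "lin_le (serial_asymmetry B) (word_length_asymmetry lepM21 lpG21 (\<Gamma> \<union> bit_transpositions))"
    unfolding eq by (rule compare(1)[OF d(2) c(2) bdd' d(1)])
  ultimately show "computational_asymmetry B \<simeq>\<^sub>l\<^sub>i\<^sub>n
      word_length_asymmetry lepM21 lpG21 (\<Gamma> \<union> bit_transpositions)"
    using computational_asymmetry_lin_le[OF assms] serial_asymmetry_lin_le[OF assms]
    by (intro lin_equivI) (blast intro: lin_le_trans)+
qed simp

end
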